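(* Any field that is finitely generated (as a field extension) over $\mathbb{Q}$, or over any subfield of $\mathbb{F}_p^{alg}$ for a prime $p$, has good heredity.
   Context: Let $F$ be a field with algebraic closure $F^{alg}$. A polynomial $P \in F[x]$ is hereditarily irreducible over $F$ if for every integer $n\ge 1$ the polynomial $P(x^n)$ is irreducible over $F$. A polynomial $P\in F[x]$ has good heredity (over $F$) if for some integer $n \geq 1$ the polynomial $P(x^n)$ factors (up to a nonzero constant) as a product of polynomials in $F[x]$ that are hereditarily irreducible over $F$. The field $F$ has good heredity if every polynomial $P \in F[x]$, none of whose roots in $F^{alg}$ is zero or a root of unity, has good heredity over $F$. $\mathbb{F}_p^{alg}$ denotes the algebraic closure of the field with $p$ elements. *)

theory Defs
  imports
    "Berlekamp_Zassenhaus.Finite_Field"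
    "HOL-Algebra.Generated_Fields"
    "HOL-Algebra.Algebraic_Closure_Type"
begin

text \<open>
  The type-class field \<open>'f\<close> is viewed as an HOL-Algebra structure through
  \<^const>\<open>ring_of_type_algebra\<close>, so that subfields, homomorphisms and generated
  subfields are the library ones. Several constants carry qualified names because
  HOL-Algebra and the Polynomial development use the same base names.
\<close>

abbreviation is_subfield :: "'k::field set \<Rightarrow> bool" where
  "is_subfield K \<equiv> subfield K ring_of_type_algebra"

text \<open>
  \<open>K\<close> is a subfield of some field \<open>'k\<close>, which need not be contained in \<open>'f\<close>; the
  extension structure is an embedding of \<open>K\<close> into \<open>'f\<close>. A unital homomorphism of
  fields is automatically injective.
\<close>

definition finitely_generated_over :: "'k::field set \<Rightarrow> 'f::field itself \<Rightarrow> bool" where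
  "finitely_generated_over K (_ :: 'f itself) \<longleftrightarrow>
     (\<exists>(h :: 'k \<Rightarrow> 'f) (S :: 'f set).
        h \<in> Ring.ring_hom (ring_of_type_algebra\<lparr>carrier := K\<rparr>) ring_of_type_algebra \<and>
        finite S \<and>
        generate_field ring_of_type_algebra (h ` K \<union> S) = UNIV)"

definition poly_at_power :: "'f::field Polynomial.poly \<Rightarrow> nat \<Rightarrow> 'f Polynomial.poly" where
  "poly_at_power P n = pcompose P (Polynomial.monom 1 n)"

definition hereditarily_irreducible :: "'f::field Polynomial.poly \<Rightarrow> bool" where
  "hereditarily_irreducible P \<longleftrightarrow> (\<forall>n\<ge>1. Factorial_Ring.irreducible (poly_at_power P n))"

definition poly_good_heredity :: "'f::field Polynomial.poly \<Rightarrow> bool" where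
  "poly_good_heredity P \<longleftrightarrow>
     (\<exists>n\<ge>1. \<exists>(c :: 'f) (Q :: 'f Polynomial.poly multiset).
        c \<noteq> 0 \<and> (\<forall>q\<in>#Q. hereditarily_irreducible q) \<and>
        poly_at_power P n = Polynomial.smult c (\<Prod>\<^sub># Q))"

definition root_of_unity :: "'a::field \<Rightarrow> bool" where
  "root_of_unity z \<longleftrightarrow> (\<exists>k\<ge>1. z ^ k = 1)"

definition field_good_heredity :: "'f::field itself \<Rightarrow> bool" where
  "field_good_heredity (_ :: 'f itself) \<longleftrightarrow>
     (\<forall>P :: 'f Polynomial.poly.
        (\<forall>z :: 'f alg_closure.
           poly (map_poly to_ac P) z = 0 \<longrightarrow> z \<noteq> 0 \<and> \<not> root_of_unity z) \<longrightarrow>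
        poly_good_heredity P)"

end

theory Submission
  imports Defs "Berlekamp_Zassenhaus.Factor_Bound"
begin

text \<open>
  Hereditary irreducibility comes from a maximality argument. Suppose that the number of nonconstant
  factors in a factorization of \<open>P(x^n)\<close> is bounded independently of \<open>n\<close>, and choose \<open>n\<close> and a
  factorization of \<open>P(x^n)\<close> with as many nonconstant factors as possible. If \<open>q(x^k)\<close> were reducible
  for one of these factors \<open>q\<close>, then \<open>P(x^(n k))\<close> would have a longer factorization. A factor of
  \<open>P(x^n)\<close> has a root \<open>x\<close> with \<open>x^n = a\<close> for one of the finitely many roots \<open>a\<close> of \<open>P\<close>, and the
  degrees of the factors add up to \<open>n deg P\<close>. It therefore suffices that for every \<open>a\<close> in the
  algebraic closure, neither zero nor a root of unity, there is a \<open>C\<close> such that every solution of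
  \<open>x^n = a\<close> has degree at least \<open>n / C\<close> over the field (\<open>linear_radical_growth\<close> below;
  \<open>C\<close> may depend on \<open>a\<close> but not on \<open>n\<close>).

  Quantified over all \<open>a\<close> of an ambient field, this property passes from \<open>K\<close> to \<open>K(t)\<close>
  (\<open>linear_radical_growth_simple_extension\<close>), so that only the base fields need arithmetic.
  If \<open>t\<close> is algebraic over \<open>K\<close>, degrees change by a bounded factor. If \<open>t\<close> is transcendental and \<open>a\<close>
  is algebraic over \<open>K\<close>, then so is \<open>x\<close>, and its degree over \<open>K(t)\<close> is its degree over \<open>K\<close>. If both
  are transcendental but \<open>a\<close> is algebraic over \<open>K(t)\<close>, then \<open>t\<close> is algebraic over \<open>K(a)\<close>; as \<open>x\<close>
  has degree \<open>n\<close> over \<open>K(a) = K(x^n)\<close>, it has degree at least \<open>n / [K(a, t) : K(a)]\<close> over \<open>K(t)\<close>.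
  Finally, if \<open>a\<close> is transcendental over \<open>K(t)\<close>, then so is every \<open>x\<close>.

  Over a subfield of an algebraic closure of a finite field, every nonzero algebraic element is a
  root of unity, and there is nothing to prove. Over the rationals, let \<open>L = \<rat>(a)\<close> and let \<open>e\<close> be the
  degree of \<open>x\<close> over \<open>L\<close>. The norm of \<open>x\<close> to \<open>L\<close> is up to sign an element whose \<open>n\<close>-th power is
  \<open>a^e\<close>, so that with \<open>g = gcd e n\<close> some \<open>b \<in> L\<close> satisfies \<open>b^n = a^g\<close>
  (\<open>power_of_radical_in_subfield\<close>). Hence \<open>b^(n/g)\<close> is \<open>a\<close> times a root of unity of \<open>L\<close>. The roots of
  unity of \<open>L\<close> are finite in number, so raising to a suitable power \<open>w\<close> gives \<open>c^m = a^w\<close> with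
  \<open>c = b^w\<close> and \<open>m = n / g\<close>. The exponents \<open>m\<close> that occur are bounded because only finitely many \<open>c\<close>
  can occur, and \<open>n = m g \<le> m e\<close>. Both finiteness claims are instances of \<open>northcott_roots\<close>: if
  \<open>q(c^m) = 0\<close> for a fixed integer polynomial \<open>q\<close>, then the primitive minimal polynomial of \<open>c\<close>
  divides \<open>q(x^m)\<close>, so the inequalities of Landau and Mignotte bound its coefficients in terms of its
  degree and of the Euclidean norm of the coefficient vector of \<open>q(x^m)\<close>, which does not depend on
  \<open>m\<close>.
\<close>

hide_const (open) Polynomials.degree Polynomials.lead_coeff Divisibility.irreducible Divisibility.prime

section \<open>Subfields and polynomials over them\<close>

lemma is_subfield_iff:
  "is_subfield K \<longleftrightarrow> (0::'a::field) \<in> K \<and> 1 \<in> K \<and> (\<forall>x\<in>K. \<forall>y\<in>K. x + y \<in> K) \<and>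
     (\<forall>x\<in>K. - x \<in> K) \<and> (\<forall>x\<in>K. \<forall>y\<in>K. x * y \<in> K) \<and> (\<forall>x\<in>K. inverse x \<in> K)"
  (is "_ \<longleftrightarrow> ?R")
proof -
  let ?S = "ring_of_type_algebra :: 'a ring"
  interpret R: field ?S by (rule field_from_type_algebra)
  have simps: "\<zero>\<^bsub>?S\<^esub> = 0" "\<one>\<^bsub>?S\<^esub> = 1" "x \<oplus>\<^bsub>?S\<^esub> y = x + y" "x \<otimes>\<^bsub>?S\<^esub> y = x * y"
    "carrier ?S = UNIV" for x y
    by (simp_all add: ring_of_type_algebra_def)
  have neg: "\<ominus>\<^bsub>?S\<^esub> x = - x" for x
    using R.minus_equality[of "- x" x] by (simp add: simps)
  have inv: "inv\<^bsub>?S\<^esub> x = inverse x" if "x \<noteq> 0" for x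
    using R.inv_char[of x "inverse x"] that by (simp add: simps)
  show ?thesis
  proof
    assume K: "is_subfield K"
    have "inverse x \<in> K" if "x \<in> K" for x
    proof (cases "x = 0")
      case False
      then show ?thesis
        using R.subfield_m_inv(1)[OF K, of x] that by (simp add: simps inv)
    qed (use that in simp)
    then show ?R
      using subringE[OF subfieldE(1)[OF K]] by (auto simp: simps neg)
  next
    assume R: ?R
    have "subring K ?S"
      by (rule R.subringI) (use R in \<open>auto simp: simps neg\<close>)
    then show "is_subfield K"
      by (rule R.subfieldI') (use R in \<open>auto simp: simps inv\<close>)
  qed
qed

lemma
  assumes "is_subfield (K :: 'a::field set)"
  shows subfield_0: "0 \<in> K" and subfield_1: "1 \<in> K"
    and subfield_add: "x \<in> K \<Longrightarrow> y \<in> K \<Longrightarrow> x + y \<in> K"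
    and subfield_uminus: "x \<in> K \<Longrightarrow> - x \<in> K"
    and subfield_diff: "x \<in> K \<Longrightarrow> y \<in> K \<Longrightarrow> x - y \<in> K"
    and subfield_mult: "x \<in> K \<Longrightarrow> y \<in> K \<Longrightarrow> x * y \<in> K"
    and subfield_inverse: "x \<in> K \<Longrightarrow> inverse x \<in> K"
    and subfield_divide: "x \<in> K \<Longrightarrow> y \<in> K \<Longrightarrow> x / y \<in> K"
    and subfield_power: "x \<in> K \<Longrightarrow> x ^ n \<in> K"
proof -
  note K = assms[unfolded is_subfield_iff]
  show "0 \<in> K" "1 \<in> K" "x \<in> K \<Longrightarrow> y \<in> K \<Longrightarrow> x + y \<in> K" "x \<in> K \<Longrightarrow> - x \<in> K"
    "x \<in> K \<Longrightarrow> y \<in> K \<Longrightarrow> x * y \<in> K" "x \<in> K \<Longrightarrow> inverse x \<in> K"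
    using K by auto
  show "x \<in> K \<Longrightarrow> y \<in> K \<Longrightarrow> x - y \<in> K"
    using K by (metis add_uminus_conv_diff)
  show "x \<in> K \<Longrightarrow> y \<in> K \<Longrightarrow> x / y \<in> K"
    using K by (metis divide_inverse)
  show "x \<in> K \<Longrightarrow> x ^ n \<in> K"
    using K by (induction n) auto
qed

lemmas subfield_closed = subfield_0 subfield_1 subfield_add subfield_uminus subfield_diff
  subfield_mult subfield_inverse subfield_divide subfield_power

lemma subfield_sum: "is_subfield K \<Longrightarrow> (\<And>i. i \<in> I \<Longrightarrow> f i \<in> K) \<Longrightarrow> sum f I \<in> K"
  by (induction I rule: infinite_finite_induct) (auto intro: subfield_closed)

text \<open>
  The degree arguments compare one element over several subfields of a single field, so fields and
  the polynomials over them are subsets of one type.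
\<close>
definition polys_over :: "'a::field set \<Rightarrow> 'a poly set" where
  "polys_over K = {p. \<forall>i. coeff p i \<in> K}"

lemma coeff_polys_over: "p \<in> polys_over K \<Longrightarrow> coeff p i \<in> K"
  by (simp add: polys_over_def)

lemma polys_over_mono: "K \<subseteq> L \<Longrightarrow> polys_over K \<subseteq> polys_over L"
  by (auto simp: polys_over_def)

context
  fixes K :: "'a::field set"
  assumes K: "is_subfield K"
begin

lemma polys_over_0: "0 \<in> polys_over K"
  and polys_over_1: "1 \<in> polys_over K"
  and polys_over_add: "p \<in> polys_over K \<Longrightarrow> q \<in> polys_over K \<Longrightarrow> p + q \<in> polys_over K"
  and polys_over_uminus: "p \<in> polys_over K \<Longrightarrow> - p \<in> polys_over K"
  and polys_over_diff: "p \<in> polys_over K \<Longrightarrow> q \<in> polys_over K \<Longrightarrow> p - q \<in> polys_over K"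
  and polys_over_monom: "c \<in> K \<Longrightarrow> monom c n \<in> polys_over K"
  and polys_over_smult: "c \<in> K \<Longrightarrow> p \<in> polys_over K \<Longrightarrow> smult c p \<in> polys_over K"
  and polys_over_mult: "p \<in> polys_over K \<Longrightarrow> q \<in> polys_over K \<Longrightarrow> p * q \<in> polys_over K"
  and polys_over_pcompose: "p \<in> polys_over K \<Longrightarrow> q \<in> polys_over K \<Longrightarrow> pcompose p q \<in> polys_over K"
  using subfield_closed[OF K]
  by (auto simp: polys_over_def coeff_monom intro!: coeff_mult_semiring_closed coeff_pcompose_semiring_closed)

lemma polys_over_const: "c \<in> K \<Longrightarrow> [:c:] \<in> polys_over K"
  using polys_over_monom[of c 0] by (simp add: monom_0)

lemma polys_over_sum: "(\<And>i. i \<in> I \<Longrightarrow> f i \<in> polys_over K) \<Longrightarrow> sum f I \<in> polys_over K"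
  by (induction I rule: infinite_finite_induct) (auto intro: polys_over_0 polys_over_add)

lemmas polys_over_closed = polys_over_0 polys_over_1 polys_over_add polys_over_uminus
  polys_over_diff polys_over_monom polys_over_smult polys_over_mult polys_over_pcompose
  polys_over_const

lemma poly_in_subfield: "p \<in> polys_over K \<Longrightarrow> x \<in> K \<Longrightarrow> poly p x \<in> K"
  unfolding poly_altdef
  by (intro subfield_sum[OF K] subfield_mult[OF K] subfield_power[OF K]) (auto intro: coeff_polys_over)

text \<open>
  Euclidean division is carried out over the whole type; the remainder stays over the subfield
  because each elimination step divides only by the leading coefficient of the divisor.
\<close>
lemma polys_over_mod:
  assumes q: "q \<in> polys_over K" and p: "p \<in> polys_over K"
  shows "p mod q \<in> polys_over K"
proof (cases "q = 0")
  case False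
  show ?thesis
    using p
  proof (induction "degree p" arbitrary: p rule: less_induct)
    case less
    show ?case
    proof (cases "degree p < degree q")
      case True
      then show ?thesis using less.prems by (simp add: mod_poly_less)
    next
      case False
      define s where "s = monom (lead_coeff p / lead_coeff q) (degree p - degree q)"
      define p' where "p' = p - s * q"
      have s: "s \<in> polys_over K"
        unfolding s_def using less.prems q
        by (intro polys_over_monom subfield_divide[OF K]) (auto intro: coeff_polys_over)
      have p': "p' \<in> polys_over K"
        unfolding p'_def using s less.prems q by (intro polys_over_closed)
      have eq: "p mod q = p' mod q"
        using mod_mult_self1[of p' s q] by (simp add: p'_def)
      show ?thesis
      proof (cases "degree p = 0")
        case True
        then have "is_unit q"
          using False \<open>q \<noteq> 0\<close> by (simp add: is_unit_iff_degree)
        then show ?thesis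
          by (simp add: unit_imp_mod_eq_0 polys_over_0)
      next
        case pos: False
        have lc: "lead_coeff q \<noteq> 0" "p \<noteq> 0"
          using \<open>q \<noteq> 0\<close> pos by auto
        have "degree (s * q) \<le> degree p"
          using degree_mult_le[of s q] degree_monom_le[of "lead_coeff p / lead_coeff q" "degree p - degree q"] False
          unfolding s_def by linarith
        then have "degree p' \<le> degree p"
          unfolding p'_def by (intro degree_diff_le) auto
        moreover have "coeff p' (degree p) = 0"
          using False lc by (simp add: p'_def s_def coeff_monom_mult)
        moreover from this have "degree p' \<noteq> degree p"
          using pos by (metis degree_0 leading_coeff_0_iff)
        ultimately have "degree p' < degree p"
          by simp
        then show ?thesis
          using less.hyps p' eq by simp
      qed
    qed
  qed
qed (use p in simp)

section \<open>Elements of bounded degree\<close>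

text \<open>
  Gaussian elimination of one equation and one unknown at a time. This is the only fact about
  dimension behind the multiplicativity of degrees.
\<close>
lemma underdetermined_system:
  assumes "finite I" "finite J" "card I < card J" "\<And>i j. i \<in> I \<Longrightarrow> j \<in> J \<Longrightarrow> A i j \<in> K"
  shows "\<exists>x. (\<forall>j\<in>J. x j \<in> K) \<and> (\<exists>j\<in>J. x j \<noteq> 0) \<and> (\<forall>i\<in>I. (\<Sum>j\<in>J. A i j * x j) = 0)"
  using assms
proof (induction I arbitrary: J A rule: finite_induct)
  case empty
  then obtain j where "j \<in> J" by (metis all_not_in_conv card.empty less_irrefl)
  then show ?case
    using K by (intro exI[of _ "\<lambda>_. 1"]) (auto intro: subfield_closed)
next
  case (insert i I)
  show ?case
  proof (cases "\<forall>j\<in>J. A i j = 0")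
    case True
    have "\<exists>x. (\<forall>j\<in>J. x j \<in> K) \<and> (\<exists>j\<in>J. x j \<noteq> 0) \<and> (\<forall>i\<in>I. (\<Sum>j\<in>J. A i j * x j) = 0)"
      using insert.prems insert.hyps by (intro insert.IH) auto
    then show ?thesis using True by auto
  next
    case False
    then obtain l where l: "l \<in> J" "A i l \<noteq> 0" by blast
    define J' where "J' = J - {l}"
    define B where "B = (\<lambda>k j. A k j - A k l * A i j / A i l)"
    have J': "finite J'" "l \<notin> J'" "J = insert l J'"
      using insert.prems l by (auto simp: J'_def)
    have "\<exists>x. (\<forall>j\<in>J'. x j \<in> K) \<and> (\<exists>j\<in>J'. x j \<noteq> 0) \<and> (\<forall>i\<in>I. (\<Sum>j\<in>J'. B i j * x j) = 0)"
      using insert.prems insert.hyps J'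
      by (intro insert.IH) (auto simp: B_def intro!: subfield_closed[OF K])
    then obtain x where x: "\<forall>j\<in>J'. x j \<in> K" "\<exists>j\<in>J'. x j \<noteq> 0"
      "\<forall>i\<in>I. (\<Sum>j\<in>J'. B i j * x j) = 0" by blast
    define y where "y = x(l := - (\<Sum>j\<in>J'. A i j * x j) / A i l)"
    have y_other: "(\<Sum>j\<in>J'. c j * y j) = (\<Sum>j\<in>J'. c j * x j)" for c
      using J' by (intro sum.cong) (auto simp: y_def)
    have "y l \<in> K"
      unfolding y_def using x(1) insert.prems l J'
      by (auto intro!: subfield_sum[OF K] subfield_uminus[OF K] subfield_divide[OF K] subfield_mult[OF K])
    moreover have "(\<Sum>j\<in>J. A i j * y j) = 0"
      using J' l by (simp add: y_other) (simp add: y_def)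
    moreover have "(\<Sum>j\<in>J. A k j * y j) = 0" if "k \<in> I" for k
    proof -
      have "(\<Sum>j\<in>J'. B k j * x j) = (\<Sum>j\<in>J'. A k j * x j) - (\<Sum>j\<in>J'. A k l / A i l * (A i j * x j))"
        by (simp add: B_def algebra_simps sum_subtractf)
      also have "\<dots> = (\<Sum>j\<in>J'. A k j * x j) - A k l / A i l * (\<Sum>j\<in>J'. A i j * x j)"
        by (simp add: sum_distrib_left)
      also have "\<dots> = (\<Sum>j\<in>J. A k j * y j)"
        using J' by (simp add: y_other) (simp add: y_def)
      finally show ?thesis using x(3) that by simp
    qed
    ultimately show ?thesis
      using x(1,2) J' by (intro exI[of _ y]) (auto simp: y_def)
  qed
qed

end

text \<open>
  An upper bound for the degree rather than the degree itself: such bounds can be transported along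
  field extensions without speaking of minimal polynomials.
\<close>
definition algebraic_deg_le :: "'a::field set \<Rightarrow> nat \<Rightarrow> 'a \<Rightarrow> bool" where
  "algebraic_deg_le K d x \<longleftrightarrow> (\<exists>p\<in>polys_over K. p \<noteq> 0 \<and> degree p \<le> d \<and> poly p x = 0)"

lemma algebraic_deg_le_mono:
  "algebraic_deg_le K d x \<Longrightarrow> K \<subseteq> L \<Longrightarrow> d \<le> e \<Longrightarrow> algebraic_deg_le L e x"
  using polys_over_mono unfolding algebraic_deg_le_def by (meson order.trans subsetD)

text \<open>
  One more power of \<open>x\<close> than there are spanning vectors: expressing \<open>1, x, x^2, \<dots>\<close> by the \<open>v i\<close>
  and solving the homogeneous system for the coordinates gives a linear relation between the powers.
\<close>
lemma algebraic_deg_le_if_powers_in_span: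
  assumes K: "is_subfield K" and I: "finite I"
    and c: "\<And>k i. i \<in> I \<Longrightarrow> c k i \<in> K" and x: "\<And>k. x ^ k = (\<Sum>i\<in>I. c k i * v i)"
  shows "algebraic_deg_le K (card I) x"
proof -
  have "\<exists>z. (\<forall>k\<in>{..card I}. z k \<in> K) \<and> (\<exists>k\<in>{..card I}. z k \<noteq> 0) \<and>
      (\<forall>i\<in>I. (\<Sum>k\<in>{..card I}. c k i * z k) = 0)"
    using I c by (intro underdetermined_system[OF K]) auto
  then obtain z where z: "\<forall>k\<le>card I. z k \<in> K" "\<exists>k\<le>card I. z k \<noteq> 0"
      "\<forall>i\<in>I. (\<Sum>k\<le>card I. c k i * z k) = 0" by auto
  define p where "p = (\<Sum>k\<le>card I. monom (z k) k)"
  have coeff: "coeff p j = (if j \<le> card I then z j else 0)" for j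
    by (simp add: p_def coeff_sum coeff_monom)
  have "poly p x = (\<Sum>k\<le>card I. z k * (\<Sum>i\<in>I. c k i * v i))"
    by (simp add: p_def poly_sum poly_monom x)
  also have "\<dots> = (\<Sum>i\<in>I. (\<Sum>k\<le>card I. c k i * z k) * v i)"
    by (simp add: sum_distrib_left sum_distrib_right mult_ac) (rule sum.swap)
  also have "\<dots> = 0" using z(3) by simp
  finally have "poly p x = 0" .
  moreover have "p \<in> polys_over K"
    using z(1) subfield_0[OF K] by (auto simp: polys_over_def coeff)
  moreover have "p \<noteq> 0" using z(2) coeff by (metis coeff_0)
  moreover have "degree p \<le> card I" by (rule degree_le) (auto simp: coeff)
  ultimately show ?thesis unfolding algebraic_deg_le_def by blast
qed

section \<open>Adjoining one element\<close>

definition simple_extension :: "'a::field set \<Rightarrow> 'a \<Rightarrow> 'a set" where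
  "simple_extension K t =
     {poly u t / poly v t | u v. u \<in> polys_over K \<and> v \<in> polys_over K \<and> poly v t \<noteq> 0}"

lemma simple_extensionI:
  "u \<in> polys_over K \<Longrightarrow> v \<in> polys_over K \<Longrightarrow> poly v t \<noteq> 0 \<Longrightarrow> x = poly u t / poly v t \<Longrightarrow>
     x \<in> simple_extension K t"
  unfolding simple_extension_def by blast

lemma simple_extensionE:
  assumes "x \<in> simple_extension K t"
  obtains u v where "u \<in> polys_over K" "v \<in> polys_over K" "poly v t \<noteq> 0" "x = poly u t / poly v t"
  using assms unfolding simple_extension_def by blast

lemma simple_extension_mono: "K \<subseteq> L \<Longrightarrow> simple_extension K t \<subseteq> simple_extension L t"
  using polys_over_mono unfolding simple_extension_def by blast

lemma poly_in_simple_extension: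
  "is_subfield K \<Longrightarrow> u \<in> polys_over K \<Longrightarrow> poly u t \<in> simple_extension K t"
  by (rule simple_extensionI[of u K 1]) (auto intro: polys_over_1)

lemma base_subset_simple_extension: "is_subfield K \<Longrightarrow> K \<subseteq> simple_extension K t"
  using poly_in_simple_extension[of K "[:c:]" t for c] by (auto simp: polys_over_const)

lemma generator_in_simple_extension: "is_subfield K \<Longrightarrow> t \<in> simple_extension K t"
  using poly_in_simple_extension[of K "monom 1 1" t]
  by (simp add: polys_over_monom subfield_1 poly_monom)

lemma is_subfield_simple_extension:
  assumes K: "is_subfield K"
  shows "is_subfield (simple_extension K t)"
proof -
  note closed = polys_over_closed[OF K] and sub = poly_in_simple_extension[OF K]
  show ?thesis
    unfolding is_subfield_iff
  proof (intro conjI ballI)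
    show "0 \<in> simple_extension K t" "1 \<in> simple_extension K t"
      using sub[of 0 t] sub[of 1 t] closed by auto
  next
    fix x y assume "x \<in> simple_extension K t" "y \<in> simple_extension K t"
    then obtain a b c d where
      x: "a \<in> polys_over K" "b \<in> polys_over K" "poly b t \<noteq> 0" "x = poly a t / poly b t" and
      y: "c \<in> polys_over K" "d \<in> polys_over K" "poly d t \<noteq> 0" "y = poly c t / poly d t"
      by (elim simple_extensionE)
    show "x + y \<in> simple_extension K t"
      by (rule simple_extensionI[of "a * d + c * b" K "b * d"])
         (use x y closed in \<open>auto simp: add_frac_eq mult.commute\<close>)
    show "x * y \<in> simple_extension K t"
      by (rule simple_extensionI[of "a * c" K "b * d"]) (use x y closed in auto)
    show "- x \<in> simple_extension K t"
      by (rule simple_extensionI[of "- a" K b]) (use x closed in auto)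
    show "inverse x \<in> simple_extension K t"
    proof (cases "poly a t = 0")
      case True
      then show ?thesis using x sub[of 0 t] closed by auto
    next
      case False
      then show ?thesis by (intro simple_extensionI[of b K a]) (use x in auto)
    qed
  qed
qed

text \<open>
  Over an algebraic generator no denominators are needed, so the extension is spanned by finitely
  many powers of the generator.
\<close>
lemma simple_extension_algebraic:
  assumes K: "is_subfield K" and t: "algebraic_deg_le K d t" and x: "x \<in> simple_extension K t"
  shows "\<exists>c. (\<forall>i<d. c i \<in> K) \<and> x = (\<Sum>i<d. c i * t ^ i)"
proof -
  note closed = polys_over_closed[OF K]
  \<comment> \<open>Remainders modulo an annihilating polynomial of \<open>t\<close> reduce every polynomial expression in \<open>t\<close>
    to degree below \<open>d\<close>; the denominator is then removed by inverting it in \<open>K[t]\<close>.\<close>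
  obtain m where m: "m \<in> polys_over K" "m \<noteq> 0" "degree m \<le> d" "poly m t = 0"
    using t unfolding algebraic_deg_le_def by blast
  have deg_m: "degree m > 0"
    using m by (cases "degree m = 0") (auto elim!: degree_eq_zeroE)
  have reduce: "\<exists>c. (\<forall>i. c i \<in> K) \<and> poly p t = (\<Sum>i<d. c i * t ^ i)" if p: "p \<in> polys_over K" for p
  proof -
    define r where "r = p mod m"
    have "poly p t = poly (p div m * m + r) t"
      by (simp only: r_def div_mult_mod_eq)
    then have "poly p t = poly r t" using m by simp
    also have deg: "degree r < d"
      using degree_mod_less'[of m p] degree_mod_less[of m p] m deg_m unfolding r_def by fastforce
    have "poly r t = (\<Sum>i<d. coeff r i * t ^ i)"
      unfolding poly_altdef using deg by (intro sum.mono_neutral_left) (auto simp: coeff_eq_0)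
    finally show ?thesis
      using polys_over_mod[OF K m(1) p] unfolding r_def by (auto intro!: exI coeff_polys_over)
  qed
  obtain u v where uv: "u \<in> polys_over K" "v \<in> polys_over K" "poly v t \<noteq> 0" "x = poly u t / poly v t"
    using x by (rule simple_extensionE)
  define y where "y = poly v t"
  have "\<forall>k. \<exists>c. (\<forall>i. c i \<in> K) \<and> y ^ k = (\<Sum>i<d. c i * t ^ i)"
  proof
    fix k
    have "v ^ k \<in> polys_over K" using uv closed by (induction k) auto
    from reduce[OF this] show "\<exists>c. (\<forall>i. c i \<in> K) \<and> y ^ k = (\<Sum>i<d. c i * t ^ i)"
      by (simp add: y_def)
  qed
  then obtain c where c: "\<And>k i. c k i \<in> K" "\<And>k. y ^ k = (\<Sum>i<d. c k i * t ^ i)" by metis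
  have "algebraic_deg_le K (card {..<d}) y"
    using c by (intro algebraic_deg_le_if_powers_in_span[OF K, of _ c _ "\<lambda>i. t ^ i"]) auto
  then obtain f where f: "f \<in> polys_over K" "f \<noteq> 0" "poly f y = 0"
    unfolding algebraic_deg_le_def by blast
  \<comment> \<open>Dividing a relation for the nonzero element \<open>y\<close> by the lowest power of \<open>y\<close> in it leaves a
    constant term, which expresses the inverse of \<open>y\<close> as a polynomial in \<open>y\<close>.\<close>
  have "\<exists>w\<in>polys_over K. inverse y = poly w y"
    using f
  proof (induction f)
    case (pCons a f)
    have a: "a \<in> K" using coeff_polys_over[OF pCons.prems(1), of 0] by simp
    have f: "f \<in> polys_over K"
      unfolding polys_over_def using coeff_polys_over[OF pCons.prems(1), of "Suc i" for i] by simp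
    show ?case
    proof (cases "a = 0")
      case True
      then have "poly f y = 0" "f \<noteq> 0" using pCons.prems uv by (auto simp: y_def)
      then show ?thesis using pCons.IH f by blast
    next
      case False
      have *: "y * poly f y = - a" using pCons.prems by (simp add: eq_neg_iff_add_eq_0 add.commute)
      have "inverse y = poly (smult (- inverse a) f) y"
      proof -
        have "y * (- inverse a * poly f y) = - inverse a * (y * poly f y)" by simp
        also have "\<dots> = 1" unfolding * using False by simp
        finally have "inverse y = - inverse a * poly f y" by (rule inverse_unique)
        then show ?thesis by simp
      qed
      moreover have "smult (- inverse a) f \<in> polys_over K"
        using a f by (intro closed subfield_closed[OF K])
      ultimately show ?thesis by blast
    qed
  qed simp
  then obtain w where w: "w \<in> polys_over K" "inverse y = poly w y" by blast
  have "x = poly (u * pcompose w v) t"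
    using uv(4) w(2) by (simp add: y_def poly_pcompose divide_inverse)
  moreover have "u * pcompose w v \<in> polys_over K" by (intro closed uv w)
  ultimately show ?thesis using reduce[of "u * pcompose w v"] by auto
qed

text \<open>
  Every power of \<open>x\<close> is a combination over \<open>K\<close> of the \<open>d * e\<close> products \<open>x^i * t^j\<close>.
\<close>
lemma algebraic_deg_le_tower:
  assumes K: "is_subfield K" and t: "algebraic_deg_le K e t"
    and x: "algebraic_deg_le (simple_extension K t) d x"
  shows "algebraic_deg_le K (d * e) x"
proof -
  define L where "L = simple_extension K t"
  have L: "is_subfield L" unfolding L_def by (rule is_subfield_simple_extension[OF K])
  have "\<exists>c. (\<forall>i j. i < d \<longrightarrow> j < e \<longrightarrow> c i j \<in> K) \<and> x ^ k = (\<Sum>(i, j)\<in>{..<d} \<times> {..<e}. c i j * (x ^ i * t ^ j))" for k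
  proof -
    have "x ^ k \<in> simple_extension L x"
      by (rule subfield_power[OF is_subfield_simple_extension[OF L] generator_in_simple_extension[OF L]])
    then obtain a where a: "\<forall>i<d. a i \<in> L" "x ^ k = (\<Sum>i<d. a i * x ^ i)"
      using simple_extension_algebraic[OF L x[folded L_def]] by blast
    have "\<forall>i\<in>{..<d}. \<exists>c. (\<forall>j<e. c j \<in> K) \<and> a i = (\<Sum>j<e. c j * t ^ j)"
      using a simple_extension_algebraic[OF K t] by (auto simp: L_def)
    then obtain c where c: "\<forall>i\<in>{..<d}. (\<forall>j<e. c i j \<in> K) \<and> a i = (\<Sum>j<e. c i j * t ^ j)"
      by (auto simp only: bchoice_iff)
    have "x ^ k = (\<Sum>i<d. \<Sum>j<e. c i j * (x ^ i * t ^ j))"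
      unfolding a(2) using c by (intro sum.cong) (auto simp: sum_distrib_right sum_distrib_left mult_ac)
    then show ?thesis using c by (intro exI[of _ c]) (auto simp: sum.cartesian_product)
  qed
  then have "\<forall>k. \<exists>c. (\<forall>i j. i < d \<longrightarrow> j < e \<longrightarrow> c i j \<in> K) \<and>
      x ^ k = (\<Sum>(i, j)\<in>{..<d} \<times> {..<e}. c i j * (x ^ i * t ^ j))" by blast
  then obtain c where c: "\<And>k i j. i < d \<Longrightarrow> j < e \<Longrightarrow> c k i j \<in> K"
    "\<And>k. x ^ k = (\<Sum>(i, j)\<in>{..<d} \<times> {..<e}. c k i j * (x ^ i * t ^ j))"
    unfolding choice_iff by blast
  have "algebraic_deg_le K (card ({..<d} \<times> {..<e})) x"
  proof (rule algebraic_deg_le_if_powers_in_span[OF K])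
    show "finite ({..<d} \<times> {..<e})" by simp
    show "c k (fst p) (snd p) \<in> K" if "p \<in> {..<d} \<times> {..<e}" for k p
      using c(1) that by auto
    show "x ^ k = (\<Sum>p\<in>{..<d} \<times> {..<e}. c k (fst p) (snd p) * (x ^ fst p * t ^ snd p))" for k
      by (rule trans[OF c(2)]) (auto intro!: sum.cong)
  qed
  then show ?thesis by (simp add: card_cartesian_product)
qed

abbreviation algebraic_over :: "'a::field set \<Rightarrow> 'a \<Rightarrow> bool" where
  "algebraic_over K x \<equiv> \<exists>d. algebraic_deg_le K d x"

lemma algebraic_overI: "p \<in> polys_over K \<Longrightarrow> p \<noteq> 0 \<Longrightarrow> poly p x = 0 \<Longrightarrow> algebraic_over K x"
  unfolding algebraic_deg_le_def by blast

lemma algebraic_deg_le_simple_extension: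
  assumes K: "is_subfield K" and x: "algebraic_deg_le K d x" and y: "y \<in> simple_extension K x"
  shows "algebraic_deg_le K d y"
proof -
  note L = is_subfield_simple_extension[OF K, of x]
  have "[:- y, 1:] \<in> polys_over (simple_extension K x)"
    using subfield_closed[OF L] y by (auto simp: polys_over_def coeff_pCons split: nat.splits)
  then have "algebraic_deg_le (simple_extension K x) 1 y"
    unfolding algebraic_deg_le_def by (intro bexI[of _ "[:- y, 1:]"]) auto
  from algebraic_deg_le_tower[OF K x this] show ?thesis by simp
qed

lemma poly_pcompose_monom_eq_0:
  "poly (pcompose p (monom 1 n)) x = 0 \<longleftrightarrow> poly p (x ^ n) = (0::'a::field)"
  by (simp add: poly_pcompose poly_monom)

text \<open>
  This lets the transcendence of \<open>a\<close> and of its radicals be used interchangeably.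
\<close>
lemma algebraic_over_power_iff:
  assumes K: "is_subfield K" and n: "n \<ge> 1"
  shows "algebraic_over K (x ^ n) \<longleftrightarrow> algebraic_over K x"
proof
  assume "algebraic_over K (x ^ n)"
  then obtain p where p: "p \<in> polys_over K" "p \<noteq> 0" "poly p (x ^ n) = 0"
    unfolding algebraic_deg_le_def by blast
  have "pcompose p (monom 1 n) \<noteq> 0"
    using p(2) n pcompose_eq_0[of p "monom 1 n"] by (auto simp: degree_monom_eq)
  moreover have "pcompose p (monom 1 n) \<in> polys_over K"
    by (intro polys_over_closed[OF K] p subfield_1[OF K])
  ultimately show "algebraic_over K x"
    using p(3) by (intro algebraic_overI[of "pcompose p (monom 1 n)"]) (auto simp: poly_pcompose_monom_eq_0)
next
  assume "algebraic_over K x"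
  moreover have "x ^ n \<in> simple_extension K x"
    by (intro subfield_power is_subfield_simple_extension generator_in_simple_extension K)
  ultimately show "algebraic_over K (x ^ n)"
    using algebraic_deg_le_simple_extension[OF K] by blast
qed

lemma common_denominator:
  fixes f :: "'i \<Rightarrow> 'a::field"
  assumes "finite I" and one: "1 \<in> R" and mult: "\<And>x y. x \<in> R \<Longrightarrow> y \<in> R \<Longrightarrow> x * y \<in> R"
    and "\<And>i. i \<in> I \<Longrightarrow> \<exists>u\<in>R. \<exists>v\<in>R. v \<noteq> 0 \<and> f i = u / v"
  shows "\<exists>D\<in>R. D \<noteq> 0 \<and> (\<forall>i\<in>I. f i * D \<in> R)"
  using assms(1,4)
proof (induction I rule: finite_induct)
  case empty
  then show ?case using one by (intro bexI[of _ 1]) auto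
next
  case (insert i I)
  then obtain D where D: "D \<in> R" "D \<noteq> 0" "\<forall>i\<in>I. f i * D \<in> R" by auto
  obtain u v where uv: "u \<in> R" "v \<in> R" "v \<noteq> 0" "f i = u / v" using insert.prems[of i] by auto
  have "f k * (D * v) \<in> R" if "k \<in> insert i I" for k
  proof (cases "k = i")
    case True
    then have "f k * (D * v) = D * u" using uv(3,4) by simp
    moreover have "D * u \<in> R" using D(1) uv(1) by (rule mult)
    ultimately show ?thesis by (simp only:)
  next
    case False
    then have "f k * D \<in> R" using D(3) that by simp
    from mult[OF this uv(2)] show ?thesis by (simp only: mult.assoc)
  qed
  then show ?case using D uv mult by (intro bexI[of _ "D * v"]) auto
qed

text \<open>
  An equation for \<open>x\<close> over \<open>K(t)\<close> becomes, after multiplication by a common denominator, a polynomial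
  relation between \<open>x\<close> and \<open>t\<close> over \<open>K\<close>. Sorting it by powers of \<open>t\<close> keeps the degree bound for
  \<open>x\<close>. The next two lemmas start from this form.
\<close>
lemma clear_denominators:
  assumes K: "is_subfield K" and x: "algebraic_deg_le (simple_extension K t) d x"
  obtains p N where "\<And>j. p j \<in> polys_over K" "\<And>j. degree (p j) \<le> d" "\<exists>j\<le>N. p j \<noteq> 0"
    "(\<Sum>j\<le>N. poly (p j) x * t ^ j) = 0"
proof -
  note closed = polys_over_closed[OF K]
  obtain f where f: "f \<in> polys_over (simple_extension K t)" "f \<noteq> 0" "degree f \<le> d" "poly f x = 0"
    using x unfolding algebraic_deg_le_def by blast
  define n where "n = degree f"
  define R where "R = (\<lambda>u. poly u t) ` polys_over K"
  have "\<exists>D\<in>R. D \<noteq> 0 \<and> (\<forall>i\<in>{..n}. coeff f i * D \<in> R)"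
  proof (rule common_denominator)
    show "1 \<in> R" unfolding R_def using closed(2) by (intro image_eqI[of _ _ 1]) auto
    fix y z assume "y \<in> R" "z \<in> R"
    then obtain u v where "u \<in> polys_over K" "v \<in> polys_over K" "y = poly u t" "z = poly v t"
      unfolding R_def by blast
    then show "y * z \<in> R"
      unfolding R_def by (intro image_eqI[of _ _ "u * v"]) (auto intro: polys_over_mult[OF K])
  next
    fix i
    obtain u v where "u \<in> polys_over K" "v \<in> polys_over K" "poly v t \<noteq> 0"
      "coeff f i = poly u t / poly v t"
      using coeff_polys_over[OF f(1)] by (rule simple_extensionE)
    then show "\<exists>u\<in>R. \<exists>v\<in>R. v \<noteq> 0 \<and> coeff f i = u / v"
      unfolding R_def by (intro bexI[of _ "poly u t"] bexI[of _ "poly v t"] conjI) auto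
  qed simp
  then obtain D where D: "D \<noteq> 0" and "\<forall>i\<in>{..n}. coeff f i * D \<in> R"
    by (elim bexE conjE)
  then have "\<forall>i\<in>{..n}. \<exists>w. w \<in> polys_over K \<and> coeff f i * D = poly w t"
    by (auto simp: R_def image_iff Bex_def)
  then obtain w where w: "\<And>i. i \<le> n \<Longrightarrow> w i \<in> polys_over K"
    and poly_w: "\<And>i. i \<le> n \<Longrightarrow> coeff f i * D = poly (w i) t"
    unfolding bchoice_iff by auto
  define N where "N = (\<Sum>i\<le>n. degree (w i))"
  define p where "p = (\<lambda>j. \<Sum>i\<le>n. monom (coeff (w i) j) i)"
  have w_sum: "poly (w i) t = (\<Sum>j\<le>N. coeff (w i) j * t ^ j)" if "i \<le> n" for i
  proof -
    have "degree (w i) \<le> N" unfolding N_def using that by (intro member_le_sum) auto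
    then show ?thesis
      unfolding poly_altdef by (intro sum.mono_neutral_left) (auto simp: coeff_eq_0)
  qed
  have coeff_p: "coeff (p j) i = (if i \<le> n then coeff (w i) j else 0)" for i j
    by (simp add: p_def coeff_sum coeff_monom)
  show ?thesis
  proof (rule that)
    show "p j \<in> polys_over K" for j
      using coeff_polys_over[OF w] subfield_0[OF K] by (auto simp: polys_over_def coeff_p)
    show "degree (p j) \<le> d" for j
      using f(3) by (intro degree_le) (auto simp: coeff_p n_def)
    have "poly (w n) t \<noteq> 0" using poly_w[of n, symmetric] D f(2) by (simp add: n_def)
    then have "\<exists>j\<le>N. coeff (w n) j \<noteq> 0"
      using w_sum[of n] by (metis (no_types, lifting) atMost_iff le_refl mult_zero_left sum.neutral)
    then show "\<exists>j\<le>N. p j \<noteq> 0"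
      using coeff_p[of _ n] by (metis coeff_0 le_refl)
    have "(\<Sum>j\<le>N. poly (p j) x * t ^ j) = (\<Sum>j\<le>N. \<Sum>i\<le>n. coeff (w i) j * t ^ j * x ^ i)"
      by (simp add: p_def poly_sum poly_monom sum_distrib_right sum_distrib_left mult_ac)
    also have "\<dots> = (\<Sum>i\<le>n. \<Sum>j\<le>N. coeff (w i) j * t ^ j * x ^ i)"
      by (rule sum.swap)
    also have "\<dots> = (\<Sum>i\<le>n. coeff f i * D * x ^ i)"
      by (intro sum.cong) (auto simp: w_sum poly_w sum_distrib_right)
    also have "\<dots> = D * poly f x"
      by (simp add: poly_altdef n_def sum_distrib_left mult_ac)
    finally show "(\<Sum>j\<le>N. poly (p j) x * t ^ j) = 0" using f(4) by simp
  qed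
qed

text \<open>
  Read as an equation for \<open>t\<close>, the relation between \<open>x\<close> and \<open>t\<close> makes \<open>t\<close> algebraic over \<open>K(x)\<close>
  unless its coefficients vanish at \<open>x\<close>, and then a nonzero one of them is an equation for \<open>x\<close> over
  \<open>K\<close> of no larger degree. For \<open>t\<close> transcendental over \<open>K(x)\<close> this says that the degree of \<open>x\<close> does
  not drop from \<open>K\<close> to \<open>K(t)\<close>; for \<open>x\<close> transcendental over \<open>K\<close> it exchanges \<open>x\<close> and \<open>t\<close> in a
  transcendence basis.
\<close>
lemma exchange:
  assumes K: "is_subfield K" and x: "algebraic_deg_le (simple_extension K t) d x"
  shows "algebraic_deg_le K d x \<or> algebraic_over (simple_extension K x) t"
proof -
  obtain p N where p: "\<And>j. p j \<in> polys_over K" "\<And>j. degree (p j) \<le> d" "\<exists>j\<le>N. p j \<noteq> 0"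
    "(\<Sum>j\<le>N. poly (p j) x * t ^ j) = 0"
    using clear_denominators[OF K x] by blast
  then obtain l where l: "l \<le> N" "p l \<noteq> 0" by blast
  show ?thesis
  proof (cases "poly (p l) x = 0")
    case True
    then show ?thesis using p l unfolding algebraic_deg_le_def by blast
  next
    case False
    define g where "g = (\<Sum>j\<le>N. monom (poly (p j) x) j)"
    have coeff_g: "coeff g j = (if j \<le> N then poly (p j) x else 0)" for j
      by (simp add: g_def coeff_sum coeff_monom)
    have "g \<in> polys_over (simple_extension K x)"
      unfolding g_def using p(1)
      by (intro polys_over_sum polys_over_monom is_subfield_simple_extension poly_in_simple_extension K)
    moreover have "g \<noteq> 0" using False l coeff_g[of l] by auto
    moreover have "poly g t = 0" using p(4) by (simp add: g_def poly_sum poly_monom)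
    ultimately show ?thesis using algebraic_overI by blast
  qed
qed

text \<open>
  For transcendental \<open>x\<close> the polynomial \<open>X^n - x^n\<close> is irreducible over \<open>K(x^n)\<close>. A relation \<open>\<Sum>j. p j (x) * x^(n j) = 0\<close>
  with all \<open>p j\<close> of degree below \<open>n\<close> is impossible because the exponents \<open>n j + i\<close> with \<open>i < n\<close> are
  distinct, so nothing cancels.
\<close>
lemma degree_radical_of_transcendental:
  assumes K: "is_subfield K" and n: "n \<ge> 1" and transc: "\<not> algebraic_over K (x ^ n)"
    and x: "algebraic_deg_le (simple_extension K (x ^ n)) d x"
  shows "n \<le> d"
proof (rule ccontr)
  assume "\<not> n \<le> d"
  obtain p N where p: "\<And>j. p j \<in> polys_over K" "\<And>j. degree (p j) \<le> d" "\<exists>j\<le>N. p j \<noteq> 0"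
    "(\<Sum>j\<le>N. poly (p j) x * (x ^ n) ^ j) = 0"
    using clear_denominators[OF K x] by blast
  then obtain l where l: "l \<le> N" "p l \<noteq> 0" by blast
  define g where "g = (\<Sum>j\<le>N. monom 1 (n * j) * p j)"
  define i where "i = degree (p l)"
  have i: "i < n" using p(2)[of l] \<open>\<not> n \<le> d\<close> by (simp add: i_def)
  have "coeff (monom 1 (n * j) * p j) (n * l + i) = (if j = l then coeff (p l) i else 0)" for j
  proof (cases j l rule: linorder_cases)
    case less
    then have "n * Suc j \<le> n * l" by (intro mult_le_mono2) auto
    then have "degree (p j) < n * l + i - n * j" using p(2)[of j] \<open>\<not> n \<le> d\<close> by simp
    then show ?thesis using less by (simp add: Polynomial.coeff_monom_mult coeff_eq_0)
  next
    case greater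
    then have "n * Suc l \<le> n * j" by (intro mult_le_mono2) auto
    then have "n * l + i < n * j" using i by simp
    then show ?thesis using greater by (simp add: Polynomial.coeff_monom_mult)
  qed (simp add: Polynomial.coeff_monom_mult)
  then have "coeff g (n * l + i) = coeff (p l) i"
    using l by (simp add: g_def coeff_sum)
  then have "g \<noteq> 0" using l by (auto simp: i_def)
  moreover have "g \<in> polys_over K"
    unfolding g_def by (intro polys_over_sum polys_over_closed subfield_1 K p)
  moreover have "poly g x = 0"
    using p(4) by (simp add: g_def poly_sum poly_monom power_mult mult.commute[of "poly _ x"])
  ultimately have "algebraic_over K x" by (intro algebraic_overI)
  then show False using transc algebraic_over_power_iff[OF K n] by blast
qed

section \<open>Linear growth of the degree of radicals\<close>

text \<open>
  The element \<open>a\<close> ranges over the whole type, not only over the elements algebraic over \<open>K\<close>: for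
  \<open>a\<close> transcendental over \<open>K\<close> the condition is vacuous, but the same \<open>a\<close> can become algebraic over
  \<open>K(t)\<close>, and in this form the property passes along the generators of a field one at a time.
\<close>
definition linear_radical_growth :: "'a::field set \<Rightarrow> bool" where
  "linear_radical_growth K \<longleftrightarrow>
     (\<forall>a. a \<noteq> 0 \<longrightarrow> \<not> root_of_unity a \<longrightarrow>
        (\<exists>C. \<forall>n\<ge>1. \<forall>x d. x ^ n = a \<longrightarrow> algebraic_deg_le K d x \<longrightarrow> n \<le> C * d))"

text \<open>
  If \<open>C\<close> serves for \<open>a\<close> over \<open>K\<close>, the constant over \<open>K(t)\<close> is \<open>C * [K(t) : K]\<close> when \<open>t\<close> is algebraic,
  \<open>C\<close> itself when \<open>t\<close> is transcendental and \<open>a\<close> algebraic over \<open>K\<close>, and \<open>[K(a, t) : K(a)]\<close> when both are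
  transcendental over \<open>K\<close> but algebraically dependent.
\<close>
lemma linear_radical_growth_simple_extension:
  fixes K :: "'a::field set"
  assumes K: "is_subfield K" and growth: "linear_radical_growth K"
  shows "linear_radical_growth (simple_extension K t)"
  unfolding linear_radical_growth_def
proof (intro allI impI)
  fix a :: 'a assume a: "a \<noteq> 0" "\<not> root_of_unity a"
  obtain C where C: "\<And>n (x::'a) d. n \<ge> 1 \<Longrightarrow> x ^ n = a \<Longrightarrow> algebraic_deg_le K d x \<Longrightarrow> n \<le> C * d"
    using growth a unfolding linear_radical_growth_def by blast
  note L = is_subfield_simple_extension[OF K, of t]
  show "\<exists>C. \<forall>n\<ge>1. \<forall>x d. x ^ n = a \<longrightarrow> algebraic_deg_le (simple_extension K t) d x \<longrightarrow> n \<le> C * d"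
  proof (cases "algebraic_over K t")
    case True
    then obtain e where e: "algebraic_deg_le K e t" by blast
    show ?thesis
    proof (intro exI[of _ "C * e"] allI impI)
      fix n x d assume n: "1 \<le> n" "x ^ n = a" "algebraic_deg_le (simple_extension K t) d x"
      show "n \<le> C * e * d"
        using C[OF n(1,2) algebraic_deg_le_tower[OF K e n(3)]] by (simp add: mult_ac)
    qed
  next
    case t: False
    show ?thesis
    proof (cases "algebraic_over K a")
      case True
      show ?thesis
      proof (intro exI[of _ C] allI impI)
        fix n x d assume n: "1 \<le> n" "x ^ n = a" "algebraic_deg_le (simple_extension K t) d x"
        have "algebraic_over K x" using True algebraic_over_power_iff[OF K n(1), of x] n(2) by simp
        then have "\<not> algebraic_over (simple_extension K x) t"
          using t algebraic_deg_le_tower[OF K] by blast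
        then have "algebraic_deg_le K d x" using exchange[OF K n(3)] by blast
        then show "n \<le> C * d" using C n by blast
      qed
    next
      case transc: False
      show ?thesis
      proof (cases "algebraic_over (simple_extension K t) a")
        case True
        then obtain e where e: "algebraic_deg_le (simple_extension K a) e t"
          using exchange[OF K] transc by blast
        show ?thesis
        proof (intro exI[of _ e] allI impI)
          fix n x d assume n: "1 \<le> n" "x ^ n = a" "algebraic_deg_le (simple_extension K t) d x"
          have "algebraic_deg_le (simple_extension (simple_extension K a) t) d x"
            using n(3) simple_extension_mono[OF base_subset_simple_extension[OF K]]
            by (rule algebraic_deg_le_mono) simp
          from algebraic_deg_le_tower[OF is_subfield_simple_extension[OF K] e this]
          have "algebraic_deg_le (simple_extension K (x ^ n)) (d * e) x"
            by (simp add: n(2))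
          from degree_radical_of_transcendental[OF K n(1) _ this]
          show "n \<le> e * d" using transc n(2) by (simp add: mult.commute)
        qed
      next
        case False
        then show ?thesis
          using algebraic_over_power_iff[OF L] by blast
      qed
    qed
  qed
qed

lemma linear_radical_growth_adjoin_finite:
  assumes K: "is_subfield K" and growth: "linear_radical_growth K" and S: "finite S"
  obtains L where "is_subfield L" "linear_radical_growth L" "K \<union> S \<subseteq> L"
proof -
  have "\<exists>L. is_subfield L \<and> linear_radical_growth L \<and> K \<union> S \<subseteq> L"
    using S
  proof (induction S rule: finite_induct)
    case empty
    then show ?case using K growth by auto
  next
    case (insert s S)
    then obtain L where L: "is_subfield L" "linear_radical_growth L" "K \<union> S \<subseteq> L" by blast
    then show ?case
      using is_subfield_simple_extension[of L s] linear_radical_growth_simple_extension[of L s]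
        base_subset_simple_extension[of L s] generator_in_simple_extension[of L s]
      by (intro exI[of _ "simple_extension L s"]) auto
  qed
  then show ?thesis using that by blast
qed

section \<open>Algebraic extensions of finite fields\<close>

lemma root_of_unity_power: "root_of_unity z \<Longrightarrow> root_of_unity (z ^ n)"
proof -
  assume "root_of_unity z"
  then obtain k where k: "k \<ge> 1" "z ^ k = 1" unfolding root_of_unity_def by blast
  have "(z ^ n) ^ k = (z ^ k) ^ n" by (simp flip: power_mult add: mult.commute)
  then show ?thesis using k unfolding root_of_unity_def by auto
qed

lemma root_of_unity_if_power:
  assumes "root_of_unity (z ^ n)" "n \<ge> 1"
  shows "root_of_unity z"
proof -
  obtain k where "k \<ge> 1" "z ^ (n * k) = 1"
    using assms(1) unfolding root_of_unity_def by (auto simp: power_mult)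
  moreover have "n * k \<ge> 1" using assms(2) calculation(1) by simp
  ultimately show ?thesis unfolding root_of_unity_def by blast
qed

lemma root_of_unity_if_powers_eq:
  assumes "z \<noteq> 0" "z ^ i = z ^ j" "i \<noteq> j"
  shows "root_of_unity z"
proof -
  have *: "root_of_unity z" if "z ^ i = z ^ j" "i < j" for i j
  proof -
    have "z ^ j = z ^ i * z ^ (j - i)" using that(2) by (simp flip: power_add)
    then have "z ^ (j - i) = 1" using that(1) assms(1) by simp
    moreover have "j - i \<ge> 1" using that(2) by simp
    ultimately show ?thesis unfolding root_of_unity_def by blast
  qed
  show ?thesis using *[of i j] *[of j i] assms by (cases "i < j") auto
qed

text \<open>
  Pigeonhole on the powers of \<open>x\<close>.
\<close>
lemma root_of_unity_if_powers_in_finite_set: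
  assumes "finite R" "\<And>n. x ^ n \<in> R" "x \<noteq> 0"
  shows "root_of_unity x"
proof -
  have "range (\<lambda>n::nat. x ^ n) \<subseteq> R" using assms(2) by blast
  then have "finite (range (\<lambda>n::nat. x ^ n))" using assms(1) by (rule finite_subset)
  then have "\<not> inj (\<lambda>n::nat. x ^ n)" using finite_imageD infinite_UNIV_nat by blast
  then show ?thesis
    using root_of_unity_if_powers_eq[OF assms(3)] unfolding inj_def by blast
qed

lemma finite_simple_extension:
  assumes K: "is_subfield K" "finite K" and x: "algebraic_over K x"
  shows "finite (simple_extension K x)"
proof -
  obtain d where d: "algebraic_deg_le K d x" using x by blast
  have "simple_extension K x \<subseteq> (\<lambda>c. \<Sum>i<d. c i * x ^ i) ` ({..<d} \<rightarrow>\<^sub>E K)"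
  proof
    fix y assume "y \<in> simple_extension K x"
    then obtain c where "\<forall>i<d. c i \<in> K" "y = (\<Sum>i<d. c i * x ^ i)"
      using simple_extension_algebraic[OF K(1) d] by blast
    then show "y \<in> (\<lambda>c. \<Sum>i<d. c i * x ^ i) ` ({..<d} \<rightarrow>\<^sub>E K)"
      by (intro image_eqI[of _ _ "restrict c {..<d}"]) auto
  qed
  then show ?thesis
    by (rule finite_subset) (simp add: finite_PiE K(2))
qed

lemma finite_subfield_adjoin_finite:
  assumes K: "is_subfield K" "finite K" and T: "finite T" "\<And>t. t \<in> T \<Longrightarrow> algebraic_over K t"
  obtains L where "is_subfield L" "finite L" "K \<union> T \<subseteq> L"
proof -
  have "\<exists>L. is_subfield L \<and> finite L \<and> K \<union> T \<subseteq> L"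
    using T
  proof (induction T rule: finite_induct)
    case empty
    then show ?case using K by auto
  next
    case (insert t T)
    then obtain L where L: "is_subfield L" "finite L" "K \<union> T \<subseteq> L" by auto
    have "algebraic_over L t"
      using insert.prems L(3) algebraic_deg_le_mono[of K _ t L] by blast
    then show ?case
      using L is_subfield_simple_extension[of L t] finite_simple_extension[of L t]
        base_subset_simple_extension[of L t] generator_in_simple_extension[of L t]
      by (intro exI[of _ "simple_extension L t"]) auto
  qed
  then show ?thesis using that by blast
qed

text \<open>
  An equation for \<open>x\<close> over \<open>H\<close> involves only finitely many elements of \<open>H\<close>, and these generate a finite
  field over \<open>K\<close>; adjoining \<open>x\<close> keeps it finite.
\<close>
lemma root_of_unity_if_algebraic:
  assumes K: "is_subfield K" "finite K" and H: "\<And>t. t \<in> H \<Longrightarrow> algebraic_over K t"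
    and x: "algebraic_over H x" "x \<noteq> 0"
  shows "root_of_unity x"
proof -
  obtain p where p: "p \<in> polys_over H" "p \<noteq> 0" "poly p x = 0"
    using x(1) unfolding algebraic_deg_le_def by blast
  have "range (coeff p) \<subseteq> insert 0 (set (coeffs p))"
    using coeff_in_coeffs[of p] by (cases "p = 0") (auto simp: range_coeff)
  then have "finite (range (coeff p))" by (rule finite_subset) simp
  moreover have "algebraic_over K t" if "t \<in> range (coeff p)" for t
    using that H coeff_polys_over[OF p(1)] by blast
  ultimately obtain L where L: "is_subfield L" "finite L" "K \<union> range (coeff p) \<subseteq> L"
    by (rule finite_subfield_adjoin_finite[OF K])
  have "p \<in> polys_over L" using L(3) by (auto simp: polys_over_def)
  then have "algebraic_over L x" using p by (intro algebraic_overI)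
  then show ?thesis
    by (rule root_of_unity_if_powers_in_finite_set[OF finite_simple_extension[OF L(1,2)] _ x(2)])
      (intro subfield_power is_subfield_simple_extension generator_in_simple_extension L(1))
qed

lemma algebraic_over_root_of_unity:
  assumes K: "is_subfield K" and x: "root_of_unity x"
  shows "algebraic_over K x"
proof -
  obtain k where k: "k \<ge> 1" "x ^ k = 1" using x unfolding root_of_unity_def by blast
  have "coeff (monom 1 k - 1) k = 1" using k(1) by simp
  then have "monom 1 k - 1 \<noteq> (0 :: 'a poly)" by (metis coeff_0 zero_neq_one)
  then show ?thesis
    using k(2) by (intro algebraic_overI[of "monom 1 k - 1"] polys_over_closed[OF K] subfield_1[OF K])
      (auto simp: poly_monom)
qed

lemma is_subfield_finite_subring:
  fixes K :: "'a::field set"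
  assumes fin: "finite K" and one: "1 \<in> K" and diff: "\<And>x y. x \<in> K \<Longrightarrow> y \<in> K \<Longrightarrow> x - y \<in> K"
    and mult: "\<And>x y. x \<in> K \<Longrightarrow> y \<in> K \<Longrightarrow> x * y \<in> K"
  shows "is_subfield K"
proof -
  have zero: "0 \<in> K" using diff[OF one one] by simp
  have neg: "- x \<in> K" if "x \<in> K" for x using diff[OF zero that] by simp
  have add: "x + y \<in> K" if "x \<in> K" "y \<in> K" for x y using diff[OF that(1) neg[OF that(2)]] by simp
  have "inverse x \<in> K" if x: "x \<in> K" for x
  proof (cases "x = 0")
    case False
    have pow: "x ^ n \<in> K" for n using x one mult by (induction n) auto
    obtain k where k: "k \<ge> 1" "x ^ k = 1"
      using root_of_unity_if_powers_in_finite_set[OF fin pow False] unfolding root_of_unity_def by blast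
    have "x * x ^ (k - 1) = 1" using k power_Suc[of x "k - 1"] by simp
    then have "inverse x = x ^ (k - 1)" by (rule inverse_unique)
    then show ?thesis using pow by simp
  qed (use zero in simp)
  then show ?thesis unfolding is_subfield_iff by (simp add: zero one add neg mult)
qed

lemma finite_prime_subfield:
  assumes "CHAR('a::field) > 0"
  shows "is_subfield (range of_int :: 'a set)" "finite (range of_int :: 'a set)"
proof -
  define p where "p = int CHAR('a)"
  have p: "p > 0" "of_int p = (0::'a)" using assms by (auto simp: p_def)
  have "(of_int n :: 'a) = of_int (n mod p)" for n
  proof -
    have "(of_int n :: 'a) = of_int (n div p * p + n mod p)" by simp
    also have "\<dots> = of_int (n mod p)" unfolding of_int_add of_int_mult p(2) by simp
    finally show ?thesis .
  qed
  then have "range of_int \<subseteq> (of_int ` {0..<p} :: 'a set)"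
    using p(1) by (metis (no_types, lifting) atLeastLessThan_iff image_eqI image_subsetI
        pos_mod_bound pos_mod_sign)
  then show fin: "finite (range of_int :: 'a set)" by (rule finite_subset) simp
  show "is_subfield (range of_int :: 'a set)"
  proof (rule is_subfield_finite_subring[OF fin])
    show "1 \<in> range (of_int :: int \<Rightarrow> 'a)" by (metis of_int_1 rangeI)
    fix x y :: 'a assume "x \<in> range of_int" "y \<in> range of_int"
    then show "x - y \<in> range of_int" "x * y \<in> range of_int"
      by (auto simp flip: of_int_diff of_int_mult)
  qed
qed

text \<open>
  The condition is vacuous here: a solution of \<open>x^n = a\<close> that is algebraic over \<open>H\<close> is zero or a root
  of unity, and so is \<open>a\<close>. Any constant works, in particular \<open>0\<close>.
\<close>
lemma linear_radical_growth_torsion_field: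
  fixes H :: "'a::field set"
  assumes char: "CHAR('a) > 0" and H: "\<And>t. t \<in> H \<Longrightarrow> t \<noteq> 0 \<Longrightarrow> root_of_unity t"
  shows "linear_radical_growth H"
  unfolding linear_radical_growth_def
proof (intro allI impI exI[of _ 0])
  fix a x :: 'a and n d :: nat
  assume a: "a \<noteq> 0" "\<not> root_of_unity a" and n: "1 \<le> n" "x ^ n = a" and x: "algebraic_deg_le H d x"
  note K = finite_prime_subfield[OF char]
  have "monom 1 1 \<in> polys_over (range of_int :: 'a set)"
    by (intro polys_over_monom subfield_1 K)
  then have zero: "algebraic_over (range of_int) (0::'a)"
    by (rule algebraic_overI) (simp_all add: poly_monom)
  have H_alg: "algebraic_over (range of_int) t" if "t \<in> H" for t
    using zero algebraic_over_root_of_unity[OF K(1)] H[OF that] by (cases "t = 0") simp_all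
  have x_alg: "algebraic_over H x" using x by (rule exI)
  have "x \<noteq> 0" using a n by auto
  with K H_alg x_alg have "root_of_unity x" by (rule root_of_unity_if_algebraic)
  then have "root_of_unity (x ^ n)" by (rule root_of_unity_power)
  then show "n \<le> 0 * d" using a(2) n(2) by simp
qed

section \<open>Finiteness of algebraic numbers of bounded degree\<close>

lemma of_int_eq_0_iff_CHAR_0: "CHAR('a::field) = 0 \<Longrightarrow> (of_int n = (0::'a)) \<longleftrightarrow> n = 0"
  by (simp add: of_int_eq_0_iff_char_dvd)

lemma of_int_poly_eq_0_iff_CHAR_0:
  "CHAR('a::field) = 0 \<Longrightarrow> of_int_poly p = (0::'a poly) \<longleftrightarrow> p = 0"
  by (simp add: poly_eq_iff of_int_eq_0_iff_CHAR_0)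

text \<open>
  Clearing denominators, for a field of fractions of integers inside a field of characteristic zero
  whose type need not belong to the class of such fields.
\<close>
lemma integer_relation:
  fixes K :: "'a::field set"
  assumes char: "CHAR('a) = 0" and K: "\<And>y. y \<in> K \<Longrightarrow> \<exists>a b. b \<noteq> 0 \<and> y = of_int a / of_int b"
    and x: "algebraic_deg_le K d x"
  obtains g where "g \<noteq> 0" "degree g \<le> d" "poly (of_int_poly g) x = 0"
proof -
  obtain p where p: "p \<in> polys_over K" "p \<noteq> 0" "degree p \<le> d" "poly p x = 0"
    using x unfolding algebraic_deg_le_def by blast
  have "\<exists>u\<in>range of_int. \<exists>v\<in>range of_int. v \<noteq> 0 \<and> coeff p i = u / v" for i
  proof -
    obtain a b where ab: "b \<noteq> 0" "coeff p i = of_int a / of_int b"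
      using K[OF coeff_polys_over[OF p(1), of i]] by blast
    then have "of_int b \<noteq> (0 :: 'a)" using of_int_eq_0_iff_CHAR_0[OF char] by simp
    then show ?thesis using ab(2) by (intro bexI[of _ "of_int a"] bexI[of _ "of_int b"] conjI) auto
  qed
  moreover have "1 \<in> range (of_int :: int \<Rightarrow> 'a)" by (metis of_int_1 rangeI)
  moreover have "x * y \<in> range of_int" if "x \<in> range of_int" "y \<in> range of_int" for x y :: 'a
    using that by (auto simp flip: of_int_mult)
  ultimately have "\<exists>D\<in>range of_int. D \<noteq> 0 \<and> (\<forall>i\<in>{..degree p}. coeff p i * D \<in> range of_int)"
    by (intro common_denominator) simp_all
  then obtain D where D: "D \<noteq> 0" "\<forall>i\<in>{..degree p}. coeff p i * D \<in> range of_int"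
    by (elim bexE conjE)
  have "coeff p i * D \<in> range of_int" for i
  proof (cases "i \<le> degree p")
    case False
    then have "coeff p i * D = of_int 0" by (simp add: coeff_eq_0)
    then show ?thesis by (rule range_eqI)
  qed (use D(2) in auto)
  then have "\<forall>i. \<exists>w. coeff p i * D = of_int w" by (simp only: image_iff) simp
  then obtain w where w: "\<And>i. coeff p i * D = of_int (w i)" unfolding choice_iff by blast
  define g where "g = (\<Sum>i\<le>degree p. monom (w i) i)"
  have "w i = 0" if "i > degree p" for i
    using w[of i] of_int_eq_0_iff_CHAR_0[OF char, of "w i"] that by (simp add: coeff_eq_0)
  then have coeff_g: "coeff g i = w i" for i
    by (auto simp: g_def coeff_sum coeff_monom)
  have g: "of_int_poly g = smult D p"
    by (rule poly_eqI) (simp add: coeff_g w[symmetric] mult.commute)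
  show ?thesis
  proof (rule that)
    show "g \<noteq> 0" using g D p(2) by auto
    show "degree g \<le> d"
      using p(3) unfolding g_def by (intro degree_sum_le) (auto intro: order.trans[OF degree_monom_le])
    show "poly (of_int_poly g) x = 0" using g p(4) by simp
  qed
qed

text \<open>
  The primitive minimal polynomial. Pseudo-division by an annihilating polynomial of least degree shows
  that it divides a nonzero multiple of every other one, and Gauss's lemma removes the multiplier
  from the divisibility by the primitive part.
\<close>
lemma primitive_annihilator:
  fixes c :: "'a::field"
  assumes char: "CHAR('a) = 0" and g: "g \<noteq> 0" "poly (of_int_poly g) c = 0"
  obtains f where "f \<noteq> 0" "degree f \<le> degree g" "poly (of_int_poly f) c = 0"
    "\<And>h. poly (of_int_poly h) c = 0 \<Longrightarrow> f dvd h"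
proof -
  define P where "P = (\<lambda>f. f \<noteq> 0 \<and> poly (of_int_poly f) c = 0)"
  define f where "f = arg_min degree P"
  have Pf: "P f" unfolding f_def by (rule arg_min_natI[of P g]) (use g in \<open>simp add: P_def\<close>)
  have min: "degree f \<le> degree h" if "P h" for h
    unfolding f_def using that by (rule arg_min_nat_le)
  define f' where "f' = primitive_part f"
  have f_eq: "f = smult (content f) f'" unfolding f'_def by simp
  have "content f \<noteq> 0" using Pf by (simp add: P_def)
  have "of_int_poly f = smult (of_int (content f)) (of_int_poly f' :: 'a poly)"
    by (subst f_eq) (simp only: of_int_hom.map_poly_hom_smult)
  then have f': "poly (of_int_poly f') c = 0"
    using Pf \<open>content f \<noteq> 0\<close> of_int_eq_0_iff_CHAR_0[OF char] by (auto simp: P_def)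
  show ?thesis
  proof (rule that)
    show "f' \<noteq> 0" using Pf by (simp add: f'_def P_def)
    show "degree f' \<le> degree g" using min[of g] g by (simp add: f'_def P_def)
    show "poly (of_int_poly f') c = 0" by (rule f')
    fix h assume h: "poly (of_int_poly h) c = 0"
    define r where "r = pseudo_mod h f"
    have "f \<noteq> 0" using Pf by (simp add: P_def)
    from pseudo_mod[OF this, of h] obtain a s where as: "a \<noteq> 0" "smult a h = f * s + r"
      and r: "r = 0 \<or> degree r < degree f" unfolding r_def by blast
    have "of_int_poly (smult a h) = (of_int_poly f * of_int_poly s + of_int_poly r :: 'a poly)"
      unfolding as(2) by (simp only: of_int_poly_hom.hom_add of_int_poly_hom.hom_mult)
    from arg_cong[OF this, of "\<lambda>p. poly p c"] have "poly (of_int_poly r) c = 0"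
      using h Pf by (simp add: of_int_hom.map_poly_hom_smult P_def)
    then have "r = 0" using r min[of r] unfolding P_def by force
    then have "f dvd smult a h" using as(2) by simp
    then show "f' dvd h" unfolding f'_def by (rule dvd_smult_int[OF as(1)])
  qed
qed

lemma norm2_pcompose_monom:
  fixes q :: "complex poly"
  assumes m: "m \<ge> 1"
  shows "norm2 (pcompose q (monom 1 m)) = norm2 q"
proof -
  have norm2: "norm2 p = (\<Sum>i\<le>degree p. (cmod (coeff p i))\<^sup>2)" for p :: "complex poly"
  proof (cases "p = 0")
    case False
    then have "coeffs p = map (coeff p) [0..<Suc (degree p)]" by (simp add: coeffs_def)
    then show ?thesis
      by (simp add: comp_def sum_list_distinct_conv_sum_set atLeast0LessThan lessThan_Suc_atMost
          del: upt_Suc)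
  qed simp
  define q' where "q' = pcompose q (monom 1 m)"
  have deg: "degree q' = degree q * m" by (simp add: q'_def degree_pcompose degree_monom_eq)
  have coeff_mult: "coeff q' (m * i) = coeff q i" for i
    unfolding q'_def using m by (intro coeff_pcompose_x_pow_n) auto
  have coeff_other: "coeff q' j = 0" if "\<not> m dvd j" for j
    using coeff_pcompose_monom[of "j mod m" m q "j div m"] m that by (auto simp: q'_def dvd_eq_mod_eq_0)
  have "norm2 q' = (\<Sum>j\<le>degree q * m. (cmod (coeff q' j))\<^sup>2)" by (simp add: norm2 deg)
  also have "\<dots> = (\<Sum>j\<in>(*) m ` {..degree q}. (cmod (coeff q' j))\<^sup>2)"
  proof (rule sum.mono_neutral_right)
    show "(*) m ` {..degree q} \<subseteq> {..degree q * m}" by (auto simp: mult.commute)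
    show "\<forall>j\<in>{..degree q * m} - (*) m ` {..degree q}. (cmod (coeff q' j))\<^sup>2 = 0"
    proof
      fix j assume j: "j \<in> {..degree q * m} - (*) m ` {..degree q}"
      have "\<not> m dvd j"
      proof
        assume "m dvd j"
        then obtain i where "j = m * i" by (elim dvdE)
        with j m show False by (auto simp: mult.commute)
      qed
      then show "(cmod (coeff q' j))\<^sup>2 = 0" by (simp add: coeff_other)
    qed
  qed simp
  also have "\<dots> = (\<Sum>i\<le>degree q. (cmod (coeff q' (m * i)))\<^sup>2)"
    using m by (subst sum.reindex) (auto simp: inj_on_def)
  also have "\<dots> = norm2 q" by (simp add: coeff_mult norm2)
  finally show ?thesis by (simp add: q'_def)
qed

text \<open>
  The bound is uniform in \<open>m\<close>. Mignotte's inequality bounds the coefficients of \<open>f\<close> by its Mahler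
  measure; multiplication by a nonzero integer polynomial does not decrease the Mahler measure; and
  Landau's inequality bounds that of \<open>q(x^m)\<close> by its Euclidean norm, which is the norm of \<open>q\<close>.
\<close>
lemma factor_of_pcompose_monom_bound:
  fixes f q :: "int poly"
  assumes f: "f dvd pcompose q (monom 1 m)" and q: "q \<noteq> 0" and m: "m \<ge> 1"
  shows "of_int \<bar>coeff f k\<bar> \<le> 2 ^ degree f * sqrt (norm2 (of_int_poly q))"
proof -
  have "pcompose q (monom 1 m) \<noteq> 0"
    using q m pcompose_eq_0[of q "monom 1 m"] by (auto simp: degree_monom_eq)
  then have "mahler_measure f \<le> mahler_measure (pcompose q (monom 1 m))"
    using f by (rule mahler_measure_dvd)
  also have "\<dots> \<le> sqrt (norm2 (of_int_poly (pcompose q (monom 1 m))))"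
    unfolding mahler_measure_def by (rule Landau_inequality)
  also have "\<dots> = sqrt (norm2 (of_int_poly q))"
    using norm2_pcompose_monom[OF m, of "of_int_poly q"] by (simp only: of_int_hom.map_poly_pcompose of_int_hom.map_poly_hom_monom of_int_1)
  finally have M: "mahler_measure f \<le> sqrt (norm2 (of_int_poly q))" .
  have "real (degree f choose k) \<le> 2 ^ degree f"
    using of_nat_mono[OF binomial_le_pow2[of "degree f" k], where 'a = real] by simp
  then have "real (degree f choose k) * mahler_measure f \<le> 2 ^ degree f * sqrt (norm2 (of_int_poly q))"
    using M by (intro mult_mono mahler_measure_ge_0) auto
  then show ?thesis using Mignotte_bound[of f k] by linarith
qed

lemma finite_int_polys_bounded:
  "finite {f :: int poly. degree f \<le> D \<and> (\<forall>k. real_of_int \<bar>coeff f k\<bar> \<le> B)}"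
proof (rule finite_imageD[of coeffs])
  show "inj_on coeffs {f :: int poly. degree f \<le> D \<and> (\<forall>k. real_of_int \<bar>coeff f k\<bar> \<le> B)}"
    by (auto simp: inj_on_def coeffs_eq_iff)
  have "coeffs ` {f :: int poly. degree f \<le> D \<and> (\<forall>k. real_of_int \<bar>coeff f k\<bar> \<le> B)}
     \<subseteq> {xs. set xs \<subseteq> {- \<lfloor>B\<rfloor>..\<lfloor>B\<rfloor>} \<and> length xs \<le> Suc D}"
  proof (rule image_subsetI)
    fix f :: "int poly" assume "f \<in> {f. degree f \<le> D \<and> (\<forall>k. real_of_int \<bar>coeff f k\<bar> \<le> B)}"
    then have f: "degree f \<le> D" "\<And>k. real_of_int \<bar>coeff f k\<bar> \<le> B" by auto
    have "\<bar>coeff f k\<bar> \<le> \<lfloor>B\<rfloor>" for k using f(2)[of k] by (simp add: le_floor_iff)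
    then have "set (coeffs f) \<subseteq> {- \<lfloor>B\<rfloor>..\<lfloor>B\<rfloor>}"
      by (auto simp: coeffs_def abs_le_iff minus_le_iff)
    moreover have "length (coeffs f) \<le> Suc D"
      using f(1) by (cases "f = 0") (auto simp: length_coeffs)
    ultimately show "coeffs f \<in> {xs. set xs \<subseteq> {- \<lfloor>B\<rfloor>..\<lfloor>B\<rfloor>} \<and> length xs \<le> Suc D}" by simp
  qed
  then show "finite (coeffs ` {f :: int poly. degree f \<le> D \<and> (\<forall>k. real_of_int \<bar>coeff f k\<bar> \<le> B)})"
    by (rule finite_subset) (simp add: finite_lists_length_le)
qed

text \<open>
  With \<open>q = X - 1\<close> this is the finiteness of the roots of unity of degree at most \<open>D\<close>; with \<open>q\<close> an
  equation for a fixed number \<open>a\<close> it is the finiteness of the radicals of \<open>a\<close>, of any exponent, that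
  have degree at most \<open>D\<close>.
\<close>
lemma northcott_roots:
  fixes q :: "int poly"
  assumes char: "CHAR('a::field) = 0" and q: "q \<noteq> 0"
  shows "finite {c :: 'a. (\<exists>g. g \<noteq> 0 \<and> degree g \<le> D \<and> poly (of_int_poly g) c = 0) \<and>
    (\<exists>m\<ge>1. poly (of_int_poly q) (c ^ m) = 0)}" (is "finite ?S")
proof -
  define B where "B = 2 ^ D * sqrt (norm2 (of_int_poly q))"
  define F where "F = {f :: int poly. degree f \<le> D \<and> (\<forall>k. real_of_int \<bar>coeff f k\<bar> \<le> B)}"
  have "?S \<subseteq> (\<Union>f\<in>F - {0}. {c. poly (of_int_poly f) c = 0})"
  proof
    fix c assume "c \<in> ?S"
    then obtain g m where g: "g \<noteq> 0" "degree g \<le> D" "poly (of_int_poly g) c = 0"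
      and m: "m \<ge> 1" "poly (of_int_poly q) (c ^ m) = 0" by blast
    obtain f where f: "f \<noteq> 0" "degree f \<le> degree g" "poly (of_int_poly f) c = 0"
      "\<And>h. poly (of_int_poly h) c = 0 \<Longrightarrow> f dvd h"
      using primitive_annihilator[OF char g(1,3)] by blast
    have "poly (of_int_poly (pcompose q (monom 1 m))) c = 0"
      using m(2) by (simp add: of_int_hom.map_poly_pcompose poly_pcompose poly_monom)
    then have dvd: "f dvd pcompose q (monom 1 m)" by (rule f(4))
    have "real_of_int \<bar>coeff f k\<bar> \<le> B" for k
    proof -
      have "real_of_int \<bar>coeff f k\<bar> \<le> 2 ^ degree f * sqrt (norm2 (of_int_poly q))"
        by (rule factor_of_pcompose_monom_bound[OF dvd q m(1)])
      also have "\<dots> \<le> B"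
        unfolding B_def using f(2) g(2)
        by (intro mult_right_mono power_increasing) (auto intro!: sum_list_nonneg)
      finally show ?thesis .
    qed
    then show "c \<in> (\<Union>f\<in>F - {0}. {c. poly (of_int_poly f) c = 0})"
      using f(1-3) g(2) by (auto simp: F_def)
  qed
  moreover have "finite (\<Union>f\<in>F - {0}. {c :: 'a. poly (of_int_poly f) c = 0})"
    using finite_int_polys_bounded[of D B] of_int_poly_eq_0_iff_CHAR_0[OF char]
    by (intro finite_UN_I poly_roots_finite) (auto simp: F_def)
  ultimately show ?thesis by (rule finite_subset)
qed

section \<open>The rational numbers\<close>

text \<open>
  The norm argument. The minimal polynomial \<open>r\<close> of \<open>x\<close> over \<open>L\<close> divides \<open>X^n - x^n\<close>, so each of its
  \<open>e\<close> roots is an \<open>n\<close>-th root of \<open>a = x^n\<close>. Their product lies in \<open>L\<close>, being up to sign the quotient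
  of the constant by the leading coefficient, and its \<open>n\<close>-th power is \<open>a^e\<close>. A Bezout relation between \<open>e\<close> and \<open>n\<close> lowers the exponent
  to the greatest common divisor.
\<close>
lemma power_of_radical_in_subfield:
  fixes L :: "'a::alg_closed_field set"
  assumes L: "is_subfield L" and n: "n \<ge> 1" and x: "x ^ n \<in> L" "x \<noteq> 0" "algebraic_deg_le L d x"
  obtains b g where "b \<in> L" "1 \<le> g" "g \<le> d" "g dvd n" "b ^ n = (x ^ n) ^ g"
proof -
  define a where "a = x ^ n"
  define P where "P = (\<lambda>p. p \<in> polys_over L \<and> p \<noteq> 0 \<and> poly p x = 0)"
  obtain p where p: "P p" "degree p \<le> d" using x(3) unfolding algebraic_deg_le_def P_def by blast
  define r where "r = arg_min degree P"
  have r: "P r" "degree r \<le> degree p"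
    unfolding r_def using arg_min_natI[of P, OF p(1)] arg_min_nat_le[of P, OF p(1)] by blast+
  have min: "degree r \<le> degree s" if "P s" for s unfolding r_def using that by (rule arg_min_nat_le)
  have "r \<in> polys_over L" "r \<noteq> 0" "poly r x = 0" using r(1) by (auto simp: P_def)
  note r' = this
  define e where "e = degree r"
  have e: "e \<ge> 1"
    using r' by (cases "e = 0") (auto simp: e_def elim!: degree_eq_zeroE)
  define f where "f = monom 1 n - [:a:]"
  have f: "f \<in> polys_over L" "poly f x = 0"
    using x(1) by (auto simp: f_def a_def poly_monom intro!: polys_over_closed[OF L] subfield_1[OF L])
  have "poly f x = poly (f div r) x * poly r x + poly (f mod r) x"
    unfolding poly_mult[symmetric] poly_add[symmetric] div_mult_mod_eq ..
  then have "poly (f mod r) x = 0" using f(2) r'(3) by simp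
  moreover have "f mod r \<in> polys_over L" using polys_over_mod[OF L r'(1) f(1)] .
  moreover have "f mod r = 0 \<or> degree (f mod r) < degree r" using degree_mod_less[OF r'(2)] .
  ultimately have "f mod r = 0" using min[of "f mod r"] unfolding P_def by force
  then have dvd: "r dvd f" by (simp add: mod_eq_0_iff_dvd)
  obtain A where A: "size A = e" "r = smult (lead_coeff r) (\<Prod>z\<in>#A. [:- z, 1:])"
    using alg_closed_imp_factorization[OF r'(2)] by (auto simp: e_def)
  have root: "z ^ n = a" if "z \<in># A" for z
  proof -
    have "[:- z, 1:] dvd (\<Prod>z\<in>#A. [:- z, 1:])" using that by (intro dvd_prod_mset) simp
    then have "[:- z, 1:] dvd r" by (subst A(2)) (rule dvd_smult)
    then have "[:- z, 1:] dvd f" using dvd by (rule dvd_trans)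
    then have "poly f z = 0" by (simp add: poly_eq_0_iff_dvd)
    then show ?thesis by (simp add: f_def poly_monom)
  qed
  define b where "b = prod_mset A"
  have "b ^ n = (\<Prod>z\<in>#A. z ^ n)" unfolding b_def by (induction A) (auto simp: power_mult_distrib)
  also have "\<dots> = (\<Prod>z\<in>#A. a)" using root by (intro arg_cong[of _ _ prod_mset] image_mset_cong)
  finally have bn: "b ^ n = a ^ e" by (simp add: A(1))
  have "poly r 0 = lead_coeff r * (\<Prod>z\<in>#A. - z)"
    by (subst A(2)) (simp add: poly_prod_mset)
  also have "(\<Prod>z\<in>#A. - z) = (- 1) ^ e * b"
    unfolding A(1)[symmetric] b_def by (induction A) auto
  finally have "poly r 0 = lead_coeff r * (- 1) ^ e * b" by simp
  then have "b = poly r 0 / (lead_coeff r * (- 1) ^ e)"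
    using r'(2) by simp
  moreover have "poly r 0 \<in> L" "lead_coeff r \<in> L" "- 1 \<in> L"
    using r'(1) L by (auto intro: poly_in_subfield subfield_closed coeff_polys_over)
  ultimately have b: "b \<in> L" by (auto intro!: subfield_closed[OF L])
  define g where "g = gcd e n"
  obtain u v where uv: "e * u = n * v + g"
    using bezout_nat[of e n] e unfolding g_def by auto
  have a: "a \<in> L" "a \<noteq> 0" using x by (auto simp: a_def)
  show ?thesis
  proof (rule that)
    show "b ^ u / a ^ v \<in> L" by (intro subfield_closed[OF L] a b)
    show "1 \<le> g" "g dvd n" using e by (auto simp: g_def Suc_le_eq)
    have "g \<le> e" using gcd_le1_nat[of e n] e by (simp add: g_def)
    then show "g \<le> d" using r(2) p(2) by (simp add: e_def)
    have "(b ^ u) ^ n = (b ^ n) ^ u" by (simp only: power_mult[symmetric] mult.commute)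
    also have "\<dots> = a ^ (e * u)" by (simp only: bn power_mult)
    also have "\<dots> = a ^ (n * v) * a ^ g" by (simp only: uv power_add)
    also have "a ^ (n * v) = (a ^ v) ^ n" by (simp only: power_mult[symmetric] mult.commute)
    finally show "(b ^ u / a ^ v) ^ n = (x ^ n) ^ g"
      using a(2) by (simp add: power_divide a_def)
  qed
qed

text \<open>
  Let \<open>L = K(a)\<close>. The exponent \<open>w\<close> kills the roots of unity of \<open>L\<close>, so that the element \<open>b\<close> of the norm
  argument satisfies an exact equation \<open>(b^w)^m = a^w\<close> with \<open>m = n / g\<close>. The set \<open>M\<close> of exponents \<open>m\<close>
  of such equations in \<open>L\<close> is finite, because the possible bases form a finite set and each of them
  determines \<open>m\<close>.
\<close>
lemma linear_radical_growth_rational: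
  fixes K :: "'a::alg_closed_field set"
  assumes char: "CHAR('a) = 0" and K: "is_subfield K"
    and rat: "\<And>y. y \<in> K \<Longrightarrow> \<exists>a b. b \<noteq> 0 \<and> y = of_int a / of_int b"
  shows "linear_radical_growth K"
  unfolding linear_radical_growth_def
proof (intro allI impI)
  fix a :: 'a assume a: "a \<noteq> 0" "\<not> root_of_unity a"
  show "\<exists>C. \<forall>n\<ge>1. \<forall>x d. x ^ n = a \<longrightarrow> algebraic_deg_le K d x \<longrightarrow> n \<le> C * d"
  proof (cases "algebraic_over K a")
    case False
    then show ?thesis using algebraic_over_power_iff[OF K] by blast
  next
    case True
    then obtain D where D: "algebraic_deg_le K D a" by blast
    define L where "L = simple_extension K a"
    have L: "is_subfield L" unfolding L_def by (rule is_subfield_simple_extension[OF K])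
    have aL: "a \<in> L" unfolding L_def by (rule generator_in_simple_extension[OF K])
    have deg_L: "\<exists>g. g \<noteq> 0 \<and> degree g \<le> D \<and> poly (of_int_poly g) c = 0" if "c \<in> L" for c
    proof -
      have "algebraic_deg_le K D c"
        using algebraic_deg_le_simple_extension[OF K D] that by (simp add: L_def)
      from integer_relation[OF char rat this] show ?thesis by blast
    qed
    define T where "T = {z \<in> L. root_of_unity z}"
    have "T \<subseteq> {c. (\<exists>g. g \<noteq> 0 \<and> degree g \<le> D \<and> poly (of_int_poly g) c = 0) \<and>
        (\<exists>m\<ge>1. poly (of_int_poly [:- 1, 1:]) (c ^ m) = 0)}"
      using deg_L by (auto simp: T_def root_of_unity_def)
    then have "finite T" by (rule finite_subset) (rule northcott_roots[OF char], simp)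
    have "\<forall>z\<in>T. \<exists>k. k \<ge> 1 \<and> z ^ k = 1" by (auto simp: T_def root_of_unity_def)
    then obtain k where k: "\<And>z. z \<in> T \<Longrightarrow> k z \<ge> 1 \<and> z ^ k z = 1" unfolding bchoice_iff by blast
    define w where "w = (\<Prod>z\<in>T. k z)"
    have "w \<noteq> 0" using k \<open>finite T\<close> by (fastforce simp: w_def)
    then have w: "w \<ge> 1" by simp
    have torsion: "z ^ w = 1" if "z \<in> T" for z
    proof -
      have "k z dvd w" unfolding w_def using \<open>finite T\<close> that by (rule dvd_prodI)
      then show ?thesis using k[OF that] by (auto simp: power_mult elim!: dvdE)
    qed
    define a' where "a' = a ^ w"
    have a': "a' \<noteq> 0" "\<not> root_of_unity a'" "a' \<in> L"
      using a root_of_unity_if_power[OF _ w] subfield_power[OF L aL] by (auto simp: a'_def)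
    obtain q where q: "q \<noteq> 0" "poly (of_int_poly q) a' = 0" using deg_L[OF a'(3)] by blast
    define S where "S = {c \<in> L. \<exists>m\<ge>1. c ^ m = a'}"
    have "S \<subseteq> {c. (\<exists>g. g \<noteq> 0 \<and> degree g \<le> D \<and> poly (of_int_poly g) c = 0) \<and>
        (\<exists>m\<ge>1. poly (of_int_poly q) (c ^ m) = 0)}"
      using deg_L q(2) by (auto simp: S_def)
    then have "finite S" by (rule finite_subset) (rule northcott_roots[OF char q(1)])
    define M where "M = {m. m \<ge> 1 \<and> (\<exists>c\<in>L. c ^ m = a')}"
    \<comment> \<open>Two exponents for one base would make it, and with it \<open>a\<close>, a root of unity.\<close>
    have inj: "m = m'" if "m \<ge> 1" "c ^ m = a'" "c ^ m' = a'" for c m m'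
    proof (rule ccontr)
      assume "m \<noteq> m'"
      moreover have "c \<noteq> 0" using that a'(1) by auto
      ultimately have "root_of_unity c" using that root_of_unity_if_powers_eq[of c m m'] by simp
      then show False using root_of_unity_power[of c m] that(2) a'(2) by simp
    qed
    have "M \<subseteq> (\<lambda>c. THE m. c ^ m = a') ` S"
    proof
      fix m assume "m \<in> M"
      then obtain c where c: "m \<ge> 1" "c \<in> L" "c ^ m = a'" by (auto simp: M_def)
      have "(THE m. c ^ m = a') = m"
        by (rule the_equality, rule c(3)) (rule inj[OF c(1,3), symmetric])
      then show "m \<in> (\<lambda>c. THE m. c ^ m = a') ` S" using c by (intro image_eqI[of _ _ c]) (auto simp: S_def)
    qed
    then have "finite M" by (rule finite_subset) (rule finite_imageI[OF \<open>finite S\<close>])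
    then obtain C where C: "\<And>m. m \<in> M \<Longrightarrow> m \<le> C" unfolding finite_nat_set_iff_bounded_le by blast
    show ?thesis
    proof (intro exI[of _ C] allI impI)
      fix n x d assume n: "1 \<le> n" "x ^ n = a" and x: "algebraic_deg_le K d x"
      have "x ^ n \<in> L" "x \<noteq> 0" using n a aL by auto
      moreover have "algebraic_deg_le L d x"
        unfolding L_def by (rule algebraic_deg_le_mono[OF x base_subset_simple_extension[OF K] order.refl])
      ultimately obtain b g where b: "b \<in> L" and g: "1 \<le> g" "g \<le> d" "g dvd n"
        and "b ^ n = (x ^ n) ^ g"
        by (rule power_of_radical_in_subfield[OF L n(1)])
      then have bn: "b ^ n = a ^ g" by (simp only: n(2))
      obtain m where m: "n = g * m" using g(3) by (elim dvdE)
      have "m \<ge> 1" using m n(1) by (cases m) auto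
      have "b ^ m / a \<in> L" by (intro subfield_closed[OF L] b aL)
      moreover have "(b ^ m / a) ^ g = 1"
        using bn a(1) by (simp add: m power_divide mult.commute flip: power_mult)
      ultimately have "b ^ m / a \<in> T" using g(1) by (auto simp: T_def root_of_unity_def)
      then have "(b ^ m / a) ^ w = 1" by (rule torsion)
      then have "(b ^ w) ^ m = a'"
        using a(1) by (simp add: power_divide a'_def mult.commute flip: power_mult)
      then have "m \<in> M" using \<open>m \<ge> 1\<close> subfield_power[OF L b, of w] by (auto simp: M_def)
      then have "m \<le> C" by (rule C)
      then have "g * m \<le> d * C" using g(2) by (rule mult_le_mono[rotated])
      then show "n \<le> C * d" by (simp add: m mult.commute)
    qed
  qed
qed

section \<open>Counting factors\<close>

lemma poly_at_power_prod_mset: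
  "poly_at_power (\<Prod>\<^sub># Q) k = (\<Prod>q\<in>#Q. poly_at_power q k)"
  by (induction Q) (auto simp: poly_at_power_def pcompose_mult pcompose_1)

lemma poly_at_power_mult:
  fixes P :: "'a::field poly"
  shows "poly_at_power (poly_at_power P n) k = poly_at_power P (n * k)"
proof -
  have "pcompose (monom 1 n) (monom 1 k) = (pcompose [:0, 1:] (monom 1 k) ^ n :: 'a poly)"
    unfolding x_as_monom pcompose_hom.hom_power[symmetric] by (simp only: x_pow_n)
  also have "pcompose [:0, 1:] (monom 1 k) = (monom 1 k :: 'a poly)"
    by (simp add: pcompose_pCons)
  also have "(monom 1 k :: 'a poly) ^ n = (monom 1 1 ^ k) ^ n"
    by (simp only: x_pow_n)
  also have "\<dots> = monom 1 (k * n)"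
    by (subst power_mult[symmetric]) (rule x_pow_n)
  finally show ?thesis
    unfolding poly_at_power_def pcompose_assoc[symmetric] by (simp only: mult.commute)
qed

lemma degree_poly_at_power: "degree (poly_at_power P n) = degree P * n"
  by (simp add: poly_at_power_def degree_pcompose degree_monom_eq)

text \<open>
  A factorization with the largest possible number of nonconstant factors, over all \<open>P(x^n)\<close>, cannot be
  refined by substituting \<open>x^k\<close>.
\<close>
lemma bounded_factor_count_imp_good_heredity:
  fixes P :: "'f::field poly"
  assumes bound: "\<And>n c Q. n \<ge> 1 \<Longrightarrow> c \<noteq> 0 \<Longrightarrow> (\<And>q. q \<in># Q \<Longrightarrow> degree q > 0) \<Longrightarrow>
      poly_at_power P n = smult c (\<Prod>\<^sub># Q) \<Longrightarrow> size Q \<le> B"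
    and "P \<noteq> 0"
  shows "poly_good_heredity P"
proof -
  define good where "good = (\<lambda>n c Q. n \<ge> 1 \<and> c \<noteq> 0 \<and> (\<forall>q\<in>#Q. degree q > 0) \<and>
      poly_at_power P n = smult c (\<Prod>\<^sub># Q))"
  define sizes where "sizes = {size Q | n c Q. good n c Q}"
  have "size Q \<le> B" if "good n c Q" for n c Q
    using bound[of n c Q] that by (simp only: good_def) blast
  then have "sizes \<subseteq> {..B}" unfolding sizes_def by blast
  then have fin: "finite sizes" by (rule finite_subset) simp
  have P1: "poly_at_power P 1 = P"
    by (simp only: poly_at_power_def x_as_monom[symmetric] pcompose_idR)
  have "\<exists>c Q. good 1 c Q"
  proof (cases "degree P = 0")
    case True
    then obtain c where "P = [:c:]" by (elim degree_eq_zeroE)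
    then have "good 1 c {#}" using \<open>P \<noteq> 0\<close> P1 by (auto simp: good_def)
    then show ?thesis by blast
  next
    case False
    then have "good 1 1 {#P#}" using P1 by (auto simp: good_def)
    then show ?thesis by blast
  qed
  then have "sizes \<noteq> {}" unfolding sizes_def by blast
  then have max: "Max sizes \<in> sizes" using fin by simp
  have "\<exists>n c Q. good n c Q \<and> size Q = k" if "k \<in> sizes" for k
    using that unfolding sizes_def by blast
  from this[OF max] obtain n c Q where Q: "good n c Q" "size Q = Max sizes"
    by (elim exE conjE)
  have "hereditarily_irreducible q" if q: "q \<in># Q" for q
    unfolding hereditarily_irreducible_def
  proof (intro allI impI, rule ccontr)
    fix k :: nat assume k: "1 \<le> k" and red: "\<not> irreducible (poly_at_power q k)"
    have "degree (poly_at_power q k) > 0"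
      using Q(1) q k by (simp add: degree_poly_at_power good_def)
    then have nontriv: "poly_at_power q k \<noteq> 0" "\<not> is_unit (poly_at_power q k)"
      by (auto simp: is_unit_iff_degree)
    then have "\<exists>u v. poly_at_power q k = u * v \<and> \<not> is_unit u \<and> \<not> is_unit v"
      using red unfolding Factorial_Ring.irreducible_def by blast
    then obtain u v where uv: "poly_at_power q k = u * v" "\<not> is_unit u" "\<not> is_unit v"
      by (elim exE conjE)
    then have "u \<noteq> 0" "v \<noteq> 0" using nontriv(1) by auto
    then have deg_uv: "degree u > 0" "degree v > 0"
      using uv(2,3) by (auto simp: is_unit_iff_degree)
    obtain R where R: "Q = add_mset q R" using q by (rule mset_add)
    define Q' where "Q' = add_mset u (add_mset v (image_mset (\<lambda>r. poly_at_power r k) R))"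
    have "poly_at_power P (n * k) = poly_at_power (smult c (\<Prod>\<^sub># Q)) k"
      using Q(1) by (simp add: good_def flip: poly_at_power_mult)
    also have "\<dots> = smult c (poly_at_power (\<Prod>\<^sub># Q) k)"
      by (simp add: poly_at_power_def pcompose_smult)
    also have "\<dots> = smult c (\<Prod>\<^sub># Q')"
      unfolding poly_at_power_prod_mset R Q'_def by (simp add: uv(1) mult.assoc)
    finally have "good (n * k) c Q'"
      using Q(1) k deg_uv by (auto simp: good_def Q'_def R degree_poly_at_power)
    then have "size Q' \<in> sizes" unfolding sizes_def by blast
    then have "size Q' \<le> size Q" unfolding Q(2) using fin by (intro Max_ge)
    then show False by (simp add: Q'_def R)
  qed
  then show ?thesis
    using Q(1) unfolding poly_good_heredity_def good_def
    by (intro exI[of _ n] exI[of _ c] exI[of _ Q]) auto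
qed

interpretation to_ac_hom: field_hom "to_ac :: 'f::field \<Rightarrow> 'f alg_closure"
  by unfold_locales auto

interpretation to_ac_poly_hom: map_poly_inj_idom_hom "to_ac :: 'f::field \<Rightarrow> 'f alg_closure" ..

text \<open>
  Each nonconstant factor \<open>q\<close> of \<open>P(x^n)\<close> has a root \<open>x\<close> whose \<open>n\<close>-th power is a root of \<open>P\<close>, so its
  degree is at least \<open>n / C\<close>, where \<open>C\<close> serves all the finitely many roots of \<open>P\<close>. Since the degrees
  add up to \<open>n * degree P\<close>, there are at most \<open>C * degree P\<close> factors.
\<close>
lemma field_good_heredity_if_linear_radical_growth:
  assumes growth: "linear_radical_growth (range (to_ac :: 'f::field \<Rightarrow> _))"
  shows "field_good_heredity TYPE('f)"
  unfolding field_good_heredity_def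
proof (intro allI impI)
  fix P :: "'f poly"
  let ?ac = "map_poly to_ac :: 'f poly \<Rightarrow> _"
  assume roots: "\<forall>z. poly (?ac P) z = 0 \<longrightarrow> z \<noteq> 0 \<and> \<not> root_of_unity z"
  then have P: "P \<noteq> 0" by auto
  define Z where "Z = {z. poly (?ac P) z = 0}"
  have Z: "finite Z" unfolding Z_def using P by (intro poly_roots_finite) simp
  have "\<forall>z\<in>Z. \<exists>C. \<forall>n\<ge>1. \<forall>x d. x ^ n = z \<longrightarrow> algebraic_deg_le (range to_ac) d x \<longrightarrow> n \<le> C * d"
    using growth roots unfolding linear_radical_growth_def Z_def by auto
  then obtain f where f: "\<And>z n x d. z \<in> Z \<Longrightarrow> n \<ge> 1 \<Longrightarrow> x ^ n = z \<Longrightarrow>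
      algebraic_deg_le (range to_ac) d x \<Longrightarrow> n \<le> f z * d"
    unfolding bchoice_iff by blast
  define C where "C = sum f Z"
  have deg_bound: "n \<le> C * degree q" if n: "n \<ge> 1" and q: "q dvd poly_at_power P n" "degree q > 0" for n q
  proof -
    obtain x where x: "poly (?ac q) x = 0"
      using alg_closed_imp_poly_has_root[of "?ac q"] q(2) by auto
    have "?ac q dvd ?ac (poly_at_power P n)" using q(1) by (rule to_ac_poly_hom.hom_dvd)
    then have "poly (?ac (poly_at_power P n)) x = 0"
      using x by (metis dvdE mult_zero_left poly_mult)
    then have xn: "x ^ n \<in> Z"
      by (simp add: Z_def poly_at_power_def to_ac_hom.map_poly_pcompose poly_pcompose poly_monom)
    have "?ac q \<in> polys_over (range to_ac)" by (auto simp: polys_over_def)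
    then have "algebraic_deg_le (range to_ac) (degree q) x"
      unfolding algebraic_deg_le_def using x q(2) by (intro bexI[of _ "?ac q"]) auto
    then have "n \<le> f (x ^ n) * degree q" using f[OF xn n refl] by blast
    also have "f (x ^ n) \<le> C" unfolding C_def using Z xn by (intro member_le_sum) auto
    finally show ?thesis by simp
  qed
  show "poly_good_heredity P"
  proof (rule bounded_factor_count_imp_good_heredity[OF _ P])
    fix n c and Q :: "'f poly multiset"
    assume n: "n \<ge> 1" and c: "c \<noteq> 0" and Q: "\<And>q. q \<in># Q \<Longrightarrow> degree q > 0"
      and eq: "poly_at_power P n = smult c (\<Prod>\<^sub># Q)"
    have "n \<le> C * degree q" if "q \<in># Q" for q
      using that Q n dvd_prod_mset[OF that] by (intro deg_bound) (auto simp: eq intro: dvd_smult)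
    then have "(\<Sum>q\<in>#Q. n) \<le> (\<Sum>q\<in>#Q. C * degree q)" by (intro sum_mset_mono) auto
    also have "\<dots> = C * (\<Sum>q\<in>#Q. degree q)" by (simp add: sum_mset_distrib_left image_mset.compositionality o_def)
    also have "(\<Sum>q\<in>#Q. degree q) = degree (\<Prod>\<^sub># Q)"
      using Q
    proof (induction Q)
      case (add q Q)
      have "q \<noteq> 0" using add.prems[of q] by auto
      moreover have "\<Prod>\<^sub># Q \<noteq> 0" using add.prems[of 0] by auto
      ultimately show ?case using add by (simp add: degree_mult_eq)
    qed simp
    also have "\<dots> = degree P * n" using c eq degree_poly_at_power[of P n] by simp
    finally show "size Q \<le> C * degree P" using n by simp
  qed
qed

section \<open>Finitely generated fields\<close>

context
  fixes K :: "'k::field set" and h :: "'k \<Rightarrow> 'a::field"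
  assumes K: "is_subfield K"
    and add: "\<And>x y. x \<in> K \<Longrightarrow> y \<in> K \<Longrightarrow> h (x + y) = h x + h y"
    and mult: "\<And>x y. x \<in> K \<Longrightarrow> y \<in> K \<Longrightarrow> h (x * y) = h x * h y"
    and one: "h 1 = 1"
begin

lemma embedding_0: "h 0 = 0"
  using add[of 0 0] subfield_0[OF K] by (metis add.right_neutral add_left_cancel)

lemma embedding_uminus: "x \<in> K \<Longrightarrow> h (- x) = - h x"
  using add[of x "- x"] subfield_uminus[OF K] embedding_0 by (simp add: eq_neg_iff_add_eq_0 add.commute)

lemma embedding_inverse: "x \<in> K \<Longrightarrow> h (inverse x) = inverse (h x)"
proof (cases "x = 0")
  case False
  assume "x \<in> K"
  then have "h x * h (inverse x) = 1"
    using mult[of x "inverse x"] subfield_inverse[OF K] False one by simp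
  then show ?thesis by (rule inverse_unique[symmetric])
qed (simp add: embedding_0)

lemma embedding_eq_0_iff: "x \<in> K \<Longrightarrow> h x = 0 \<longleftrightarrow> x = 0"
  using mult[of x "inverse x"] subfield_inverse[OF K, of x] one embedding_0 by (cases "x = 0") auto

lemma embedding_power: "x \<in> K \<Longrightarrow> h (x ^ n) = h x ^ n"
  by (induction n) (auto simp: one mult subfield_power[OF K])

lemma embedding_of_nat: "of_nat n \<in> K \<and> h (of_nat n) = of_nat n"
  by (induction n) (auto simp: embedding_0 one add subfield_0[OF K] subfield_1[OF K] subfield_add[OF K])

lemma embedding_of_int: "of_int n \<in> K \<and> h (of_int n) = of_int n"
  using embedding_of_nat embedding_uminus subfield_uminus[OF K]
  by (cases n rule: int_cases2) auto

lemma embedding_CHAR: "CHAR('a) = CHAR('k)"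
proof (rule CHAR_eqI)
  show "of_nat CHAR('k) = (0 :: 'a)"
    using embedding_of_nat[of "CHAR('k)"] embedding_0 by simp
  show "CHAR('k) dvd n" if "of_nat n = (0 :: 'a)" for n
    using that embedding_of_nat[of n] embedding_eq_0_iff[of "of_nat n"] by (simp add: of_nat_eq_0_iff_char_dvd)
qed

lemma is_subfield_embedding_image: "is_subfield (h ` K)"
  unfolding is_subfield_iff
proof (intro conjI ballI)
  note closed = subfield_closed[OF K]
  show "0 \<in> h ` K" using embedding_0 closed(1) by (metis imageI)
  show "1 \<in> h ` K" using one closed(2) by (metis imageI)
  fix x y assume "x \<in> h ` K" "y \<in> h ` K"
  then obtain u v where uv: "u \<in> K" "v \<in> K" "x = h u" "y = h v" by blast
  show "x + y \<in> h ` K" using uv closed add by (intro image_eqI[of _ _ "u + v"]) auto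
  show "x * y \<in> h ` K" using uv closed mult by (intro image_eqI[of _ _ "u * v"]) auto
  show "- x \<in> h ` K" using uv closed embedding_uminus by (intro image_eqI[of _ _ "- u"]) auto
  show "inverse x \<in> h ` K" using uv closed embedding_inverse by (intro image_eqI[of _ _ "inverse u"]) auto
qed

end

lemma linear_radical_growth_mono:
  assumes "linear_radical_growth L" "K \<subseteq> L"
  shows "linear_radical_growth K"
  using assms algebraic_deg_le_mono[OF _ assms(2) order.refl]
  unfolding linear_radical_growth_def by meson

lemma ring_hom_type_algebra:
  assumes "h \<in> Ring.ring_hom (ring_of_type_algebra\<lparr>carrier := K\<rparr>) ring_of_type_algebra"
  shows "x \<in> K \<Longrightarrow> y \<in> K \<Longrightarrow> h (x + y) = h x + h y" "x \<in> K \<Longrightarrow> y \<in> K \<Longrightarrow> h (x * y) = h x * h y"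
    "h 1 = 1"
  using assms by (auto simp: Ring.ring_hom_def ring_of_type_algebra_def)

text \<open>
  The elements of the field whose images lie in a suitable subfield of the closure form a subfield
  containing the generators, hence everything; so the closure needs a subfield with linear growth
  only around the generators.
\<close>
lemma field_good_heredity_if_generated:
  fixes B S :: "'f::field set"
  assumes growth: "linear_radical_growth (to_ac ` B)" and sub: "is_subfield (to_ac ` B)"
    and S: "finite S" and gen: "generate_field ring_of_type_algebra (B \<union> S) = UNIV"
  shows "field_good_heredity TYPE('f)"
proof -
  obtain L :: "'f alg_closure set" where L: "is_subfield L" "linear_radical_growth L" "to_ac ` B \<union> to_ac ` S \<subseteq> L"
    using linear_radical_growth_adjoin_finite[OF sub growth finite_imageI[OF S]] .
  interpret R: field "ring_of_type_algebra :: 'f ring" by (rule field_from_type_algebra)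
  have "is_subfield {x :: 'f. to_ac x \<in> L}"
    unfolding is_subfield_iff using subfield_closed[OF L(1)] by simp
  moreover have "B \<union> S \<subseteq> {x. to_ac x \<in> L}" using L(3) by blast
  ultimately have "generate_field ring_of_type_algebra (B \<union> S) \<subseteq> {x. to_ac x \<in> L}"
    by (intro R.generate_field_min_subfield1) (auto simp: ring_of_type_algebra_def)
  then have "range to_ac \<subseteq> L" unfolding gen by blast
  then show ?thesis
    using linear_radical_growth_mono[OF L(2)] field_good_heredity_if_linear_radical_growth by blast
qed

lemma root_of_unity_alg_closure_mod_ring:
  fixes x :: "'p::prime_card mod_ring alg_closure"
  assumes "x \<noteq> 0"
  shows "root_of_unity x"
proof -
  have fin: "finite (range (to_ac :: 'p mod_ring \<Rightarrow> _))" by simp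
  have "is_subfield (range (to_ac :: 'p mod_ring \<Rightarrow> _))"
  proof (rule is_subfield_finite_subring[OF fin])
    show "1 \<in> range (to_ac :: 'p mod_ring \<Rightarrow> _)" by (rule range_eqI[of _ _ 1]) simp
    fix x y :: "'p mod_ring alg_closure" assume "x \<in> range to_ac" "y \<in> range to_ac"
    then obtain u v where "x = to_ac u" "y = to_ac v" by blast
    then show "x - y \<in> range to_ac" "x * y \<in> range to_ac"
      using range_eqI[of _ to_ac "u - v"] range_eqI[of _ to_ac "u * v"] by simp_all
  qed
  moreover obtain p :: "'p mod_ring poly" where p: "p \<noteq> 0" "poly (map_poly to_ac p) x = 0"
    by (rule alg_closure_algebraic)
  then have "algebraic_over (range to_ac) x"
    by (intro algebraic_overI[of "map_poly to_ac p"]) (auto simp: polys_over_def)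
  ultimately have "finite (simple_extension (range to_ac) x)"
    and "\<And>n. x ^ n \<in> simple_extension (range to_ac) x"
    using fin by (auto intro: finite_simple_extension subfield_power is_subfield_simple_extension
        generator_in_simple_extension)
  then show ?thesis using assms by (rule root_of_unity_if_powers_in_finite_set)
qed

theorem corollary33:
  assumes "finitely_generated_over (UNIV :: rat set) TYPE('f::field) \<or>
    (\<exists>K :: 'p::prime_card mod_ring alg_closure set.
       is_subfield K \<and> finitely_generated_over K TYPE('f))"
  shows "field_good_heredity TYPE('f)"
  using assms
proof (elim disjE exE conjE)
  assume "finitely_generated_over (UNIV :: rat set) TYPE('f)"
  then obtain h :: "rat \<Rightarrow> 'f" and S where
    h: "h \<in> Ring.ring_hom (ring_of_type_algebra\<lparr>carrier := UNIV\<rparr>) ring_of_type_algebra"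
    and S: "finite S" "generate_field ring_of_type_algebra (range h \<union> S) = UNIV"
    unfolding finitely_generated_over_def by blast
  define g where "g = (\<lambda>x. to_ac (h x))"
  have g: "g (x + y) = g x + g y" "g (x * y) = g x * g y" "g 1 = 1" for x y
    by (simp_all add: g_def ring_hom_type_algebra[OF h])
  have Q: "is_subfield (UNIV :: rat set)" by (simp add: is_subfield_iff)
  note embedding = Q g
  have range: "to_ac ` range h = range g" by (auto simp: g_def)
  have sub: "is_subfield (range g)" by (rule is_subfield_embedding_image[OF embedding])
  have "CHAR('f alg_closure) = 0" using embedding_CHAR[OF embedding] by simp
  then have "linear_radical_growth (range g)"
  proof (rule linear_radical_growth_rational[OF _ sub])
    fix y assume "y \<in> range g"
    then obtain x where y: "y = g x" by blast
    obtain a b where "x = Rat.Fract a b" "b > 0" by (cases x)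
    then have ab: "b \<noteq> 0" "x = of_int a * inverse (of_int b)"
      by (simp_all add: Fract_of_int_quotient divide_inverse)
    have "y = of_int a / of_int b"
      using embedding_of_int[OF embedding] embedding_inverse[OF embedding]
      by (simp add: y ab(2) g(2) divide_inverse)
    then show "\<exists>a b. b \<noteq> 0 \<and> y = of_int a / of_int b" using ab(1) by blast
  qed
  then show ?thesis
    using sub S unfolding range[symmetric] by (intro field_good_heredity_if_generated)
next
  fix K :: "'p mod_ring alg_closure set"
  assume K: "is_subfield K" and "finitely_generated_over K TYPE('f)"
  then obtain h :: "'p mod_ring alg_closure \<Rightarrow> 'f" and S where
    h: "h \<in> Ring.ring_hom (ring_of_type_algebra\<lparr>carrier := K\<rparr>) ring_of_type_algebra"
    and S: "finite S" "generate_field ring_of_type_algebra (h ` K \<union> S) = UNIV"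
    unfolding finitely_generated_over_def by blast
  define g where "g = (\<lambda>x. to_ac (h x))"
  have g: "x \<in> K \<Longrightarrow> y \<in> K \<Longrightarrow> g (x + y) = g x + g y" "x \<in> K \<Longrightarrow> y \<in> K \<Longrightarrow> g (x * y) = g x * g y"
    "g 1 = 1" for x y
    by (simp_all add: g_def ring_hom_type_algebra[OF h])
  note embedding = K g
  have range: "to_ac ` h ` K = g ` K" by (auto simp: g_def)
  have sub: "is_subfield (g ` K)" by (rule is_subfield_embedding_image[OF embedding])
  have "CHAR('p mod_ring) > 0" by (rule finite_imp_CHAR_pos) simp
  then have "CHAR('f alg_closure) > 0" using embedding_CHAR[OF embedding] by simp
  then have "linear_radical_growth (g ` K)"
  proof (rule linear_radical_growth_torsion_field)
    fix t assume "t \<in> g ` K" "t \<noteq> 0"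
    then obtain y where y: "y \<in> K" "t = g y" by blast
    have "y \<noteq> 0" using \<open>t \<noteq> 0\<close> y embedding_0[OF embedding] by auto
    then obtain k where k: "k \<ge> 1" "y ^ k = 1"
      using root_of_unity_alg_closure_mod_ring unfolding root_of_unity_def by blast
    have "t ^ k = 1" using embedding_power[OF embedding y(1), of k] k(2) y(2) g(3) by simp
    then show "root_of_unity t" using k(1) unfolding root_of_unity_def by blast
  qed
  then show ?thesis
    using sub S unfolding range[symmetric] by (intro field_good_heredity_if_generated)
qed

end
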